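(* Let $\mathcal{H}_1$ be the class of $2$-edge $n$-extremal minimal bipartite matching covered graphs and $\mathcal{H}_2$ the class of $2$-vertex extremal minimal bipartite matching covered graphs. Then $\mathcal{H}_1\cap\mathcal{H}_2=\{\Theta\}$ (up to isomorphism).
   Context: All graphs are finite and loopless; parallel edges are allowed. For a graph $G=(V,E)$ write $n=|V|$ and $m=|E|$. A connected graph on four or more vertices is matching covered if every edge lies in some perfect matching. A matching covered graph is minimal if deleting any single edge yields a graph that is not matching covered. $V_2$ is the set of vertices of degree two and $E_2$ the set of edges both of whose ends have degree two. A minimal bipartite matching covered graph is $2$-edge $n$-extremal if $|E_2|=\frac{n+10}{6}$, and $2$-vertex extremal if $|V_2|=2(m-n+2)$. $\Theta$ is the graph on $8$ vertices and $9$ edges consisting of two vertices joined by three internally disjoint paths, each of length three. *)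

theory Defs
  imports Complex_Main
begin

text \<open>
  Undirected graphs with parallel edges: edges have their own identity, and \<open>ends e\<close> is the
  set of end vertices of \<open>e\<close>. An edge with exactly two ends is not a loop.
\<close>

record ('v, 'e) mgraph =
  verts :: "'v set"
  edges :: "'e set"
  ends :: "'e \<Rightarrow> 'v set"

definition multigraph :: "('v, 'e) mgraph \<Rightarrow> bool" where
  "multigraph G \<longleftrightarrow> finite (verts G) \<and> finite (edges G) \<and>
     (\<forall>e\<in>edges G. ends G e \<subseteq> verts G \<and> card (ends G e) = 2)"

definition adjacency :: "('v, 'e) mgraph \<Rightarrow> ('v \<times> 'v) set" where
  "adjacency G = {(u, v). \<exists>e\<in>edges G. ends G e = {u, v}}"

definition connected_graph :: "('v, 'e) mgraph \<Rightarrow> bool" where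
  "connected_graph G \<longleftrightarrow> verts G \<noteq> {} \<and>
     (\<forall>u\<in>verts G. \<forall>v\<in>verts G. (u, v) \<in> (adjacency G)\<^sup>*)"

definition bipartite :: "('v, 'e) mgraph \<Rightarrow> bool" where
  "bipartite G \<longleftrightarrow> (\<exists>A B. A \<union> B = verts G \<and> A \<inter> B = {} \<and>
     (\<forall>e\<in>edges G. \<exists>a\<in>A. \<exists>b\<in>B. ends G e = {a, b}))"

definition perfect_matching :: "('v, 'e) mgraph \<Rightarrow> 'e set \<Rightarrow> bool" where
  "perfect_matching G M \<longleftrightarrow> M \<subseteq> edges G \<and>
     (\<forall>v\<in>verts G. \<exists>!e. e \<in> M \<and> v \<in> ends G e)"

definition matching_covered :: "('v, 'e) mgraph \<Rightarrow> bool" where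
  "matching_covered G \<longleftrightarrow> multigraph G \<and> connected_graph G \<and> card (verts G) \<ge> 4 \<and>
     (\<forall>e\<in>edges G. \<exists>M. perfect_matching G M \<and> e \<in> M)"

definition delete_edge :: "('v, 'e) mgraph \<Rightarrow> 'e \<Rightarrow> ('v, 'e) mgraph" where
  "delete_edge G e = G\<lparr>edges := edges G - {e}\<rparr>"

definition minimal_matching_covered :: "('v, 'e) mgraph \<Rightarrow> bool" where
  "minimal_matching_covered G \<longleftrightarrow> matching_covered G \<and>
     (\<forall>e\<in>edges G. \<not> matching_covered (delete_edge G e))"

definition degree :: "('v, 'e) mgraph \<Rightarrow> 'v \<Rightarrow> nat" where
  "degree G v = card {e \<in> edges G. v \<in> ends G e}"

definition V2 :: "('v, 'e) mgraph \<Rightarrow> 'v set" where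
  "V2 G = {v \<in> verts G. degree G v = 2}"

definition E2 :: "('v, 'e) mgraph \<Rightarrow> 'e set" where
  "E2 G = {e \<in> edges G. \<forall>v\<in>ends G e. degree G v = 2}"

definition two_edge_n_extremal :: "('v, 'e) mgraph set" where
  "two_edge_n_extremal = {G. minimal_matching_covered G \<and> bipartite G \<and>
     real (card (E2 G)) = (real (card (verts G)) + 10) / 6}"

definition two_vertex_extremal :: "('v, 'e) mgraph set" where
  "two_vertex_extremal = {G. minimal_matching_covered G \<and> bipartite G \<and>
     int (card (V2 G)) = 2 * (int (card (edges G)) - int (card (verts G)) + 2)}"

definition isomorphic :: "('v, 'e) mgraph \<Rightarrow> ('w, 'f) mgraph \<Rightarrow> bool" where
  "isomorphic G H \<longleftrightarrow> (\<exists>f g. bij_betw f (verts G) (verts H) \<and>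
     bij_betw g (edges G) (edges H) \<and> (\<forall>e\<in>edges G. ends H (g e) = f ` ends G e))"

text \<open>The three paths 0-2-3-1, 0-4-5-1 and 0-6-7-1 join the vertices 0 and 1.\<close>

definition Theta :: "(nat, nat set) mgraph" where
  "Theta = \<lparr>verts = {0..<8},
     edges = {{0, 2}, {2, 3}, {3, 1}, {0, 4}, {4, 5}, {5, 1}, {0, 6}, {6, 7}, {7, 1}},
     ends = (\<lambda>e. e)\<rparr>"

end

theory Submission imports Defs begin

text \<open>
  A bipartite graph with colour classes \<open>A\<close>, \<open>B\<close> of equal size is matching covered iff every
  nonempty proper \<open>D \<subseteq> B\<close> has more than \<open>|D|\<close> neighbours (Hall). It is minimal iff, moreover, each edge
  \<open>ab\<close> has a \<^emph>\<open>branch\<close>: a set \<open>D\<close> with \<open>|N(D)| \<le> |D| + 1\<close> that meets \<open>N(a)\<close> only in \<open>b\<close>. By submodularity, the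
  branches at a vertex \<open>a\<close> of degree at least three are pairwise disjoint.

  Put \<open>k = m - n + 2\<close>. Each colour class has at least \<open>k\<close> vertices of degree two: a vertex of degree two of
  \<open>B\<close> with both neighbours of degree at least three can be contracted (merging its neighbours)
  without changing \<open>k\<close> or the vertices of degree two in \<open>A\<close>; when there is none, a counting argument with branches
  applies. If \<open>|V\<^sub>2| = 2k\<close>, no such contraction is possible, since it would violate the bound for \<open>B\<close>. Hence every
  vertex of degree two of \<open>B\<close> has a neighbour of degree two and \<open>|E\<^sub>2| \<ge> k\<close>. Together with
  \<open>n \<le> 4k - 4\<close> and \<open>|E\<^sub>2| = (n + 10) / 6\<close> this leaves only \<open>n = 8\<close>, \<open>m = 9\<close>, \<open>|E\<^sub>2| = 3\<close>,
  where the graph is forced to be \<open>\<Theta>\<close>.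
\<close>

section \<open>Minimal surplus relations\<close>

lemma Int_Image_singletonD:
  assumes "D \<inter> E `` {a} = {b}"
  shows "b \<in> D" "(a, b) \<in> E" "x \<in> D \<Longrightarrow> (a, x) \<in> E \<Longrightarrow> x = b"
proof -
  show "b \<in> D" "(a, b) \<in> E" using equalityD2[OF assms] by auto
  show "x \<in> D \<Longrightarrow> (a, x) \<in> E \<Longrightarrow> x = b" using equalityD1[OF assms] by auto
qed

lemma Int_Image_singletonI:
  "b \<in> D \<Longrightarrow> (a, b) \<in> E \<Longrightarrow> (\<And>x. x \<in> D \<Longrightarrow> (a, x) \<in> E \<Longrightarrow> x = b) \<Longrightarrow> D \<inter> E `` {a} = {b}"
  by blast

text \<open>\<open>E\<close> is a simple bipartite graph given as a relation. A set \<open>D\<close>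
  as in \<open>minimal\<close> loses exactly the neighbour \<open>a\<close> when
  \<open>(a, b)\<close> is deleted, so the deletion leaves \<open>D\<close> without surplus.\<close>

locale minimal_surplus =
  fixes A :: "'a set" and B :: "'b set" and E :: "('a \<times> 'b) set"
  assumes finA: "finite A" and finB: "finite B" and E_sub: "E \<subseteq> A \<times> B"
    and card_eq: "card A = card B" and card_ge2: "2 \<le> card B"
    and surplus: "\<And>D. D \<subseteq> B \<Longrightarrow> D \<noteq> {} \<Longrightarrow> D \<noteq> B \<Longrightarrow> card D < card (E\<inverse> `` D)"
    and minimal: "\<And>a b. (a, b) \<in> E \<Longrightarrow>
      \<exists>D\<subseteq>B. D \<inter> E `` {a} = {b} \<and> card (E\<inverse> `` D) \<le> card D + 1"
begin

lemma finE: "finite E"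
  using E_sub finA finB finite_subset by blast

lemma branchE:
  assumes "(a, b) \<in> E"
  obtains D where "D \<subseteq> B" "D \<inter> E `` {a} = {b}" "card (E\<inverse> `` D) \<le> card D + 1"
  using minimal[OF assms] by (elim exE conjE)

lemma nbrA: "E\<inverse> `` D \<subseteq> A"
  using E_sub by auto

lemma nbrB: "E `` S \<subseteq> B"
  using E_sub by auto

lemma fin_nbrA [simp]: "finite (E\<inverse> `` D)"
  using nbrA finA finite_subset by blast

lemma fin_nbrB [simp]: "finite (E `` S)"
  using nbrB finB finite_subset by blast

text \<open>If all neighbours of \<open>a\<close> lay in \<open>{b}\<close>, then
  \<open>B - {b}\<close>, which is nonempty by \<open>card_ge2\<close>, would by
  \<open>surplus\<close> still have all of \<open>A\<close> as neighbours, including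
  \<open>a\<close>.\<close>

lemma degA_ge2:
  assumes "a \<in> A" shows "2 \<le> card (E `` {a})"
proof (rule ccontr)
  assume "\<not> 2 \<le> card (E `` {a})"
  hence c: "card (E `` {a}) \<le> 1" by simp
  obtain b where b: "b \<in> B" "E `` {a} \<subseteq> {b}"
  proof (cases "E `` {a} = {}")
    case True
    obtain b where "b \<in> B" using card_ge2 by fastforce
    thus ?thesis using True that by blast
  next
    case False
    hence "card (E `` {a}) = 1" using c by (simp add: le_Suc_eq card_eq_0_iff)
    then obtain b where "E `` {a} = {b}" using card_1_singletonE by blast
    thus ?thesis using that nbrB by blast
  qed
  have cD: "card (B - {b}) = card B - 1" using b finB by simp
  hence "card (B - {b}) < card (E\<inverse> `` (B - {b}))"
    using card_ge2 b card_mono[of "{b}" B] by (intro surplus) auto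
  hence "card A \<le> card (E\<inverse> `` (B - {b}))" using cD card_eq by linarith
  hence "E\<inverse> `` (B - {b}) = A" using nbrA finA by (metis card_seteq)
  thus False using assms b by blast
qed

text \<open>Submodularity: the surplus of union and intersection bounds |N(D \<union> D')| + |N(D)
  \<inter> N(D')| below by |D| + |D'| + 2, which the last two hypotheses make an upper bound, so
  every inequality is tight. That the union is not \<open>B\<close> makes \<open>surplus\<close>
  available for it.\<close>

lemma nbr_inter:
  assumes "D \<subseteq> B" "D' \<subseteq> B" "D \<inter> D' \<noteq> {}" "D \<union> D' \<noteq> B"
    and "card (E\<inverse> `` D) \<le> card D + 1" "card (E\<inverse> `` D') \<le> card D' + 1"
  shows "E\<inverse> `` D \<inter> E\<inverse> `` D' = E\<inverse> `` (D \<inter> D')"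
    and "card (E\<inverse> `` (D \<inter> D')) \<le> card (D \<inter> D') + 1"
proof -
  have fin: "finite D" "finite D'" using assms finB finite_subset by auto
  have 1: "card (E\<inverse> `` D) + card (E\<inverse> `` D')
      = card (E\<inverse> `` (D \<union> D')) + card (E\<inverse> `` D \<inter> E\<inverse> `` D')"
    using card_Un_Int[of "E\<inverse> `` D" "E\<inverse> `` D'"] by (simp add: Image_Un)
  have 2: "card D + card D' = card (D \<union> D') + card (D \<inter> D')"
    using fin by (rule card_Un_Int)
  have 3: "card (D \<union> D') < card (E\<inverse> `` (D \<union> D'))"
    using assms by (intro surplus) auto
  have 4: "card (D \<inter> D') < card (E\<inverse> `` (D \<inter> D'))"
    using assms by (intro surplus) auto
  have 5: "E\<inverse> `` (D \<inter> D') \<subseteq> E\<inverse> `` D \<inter> E\<inverse> `` D'" by auto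
  have le: "card (E\<inverse> `` D \<inter> E\<inverse> `` D') \<le> card (D \<inter> D') + 1"
    using 1 2 3 assms by linarith
  show "E\<inverse> `` D \<inter> E\<inverse> `` D' = E\<inverse> `` (D \<inter> D')"
    using 4 le by (intro sym[OF card_seteq[OF _ 5]]) auto
  thus "card (E\<inverse> `` (D \<inter> D')) \<le> card (D \<inter> D') + 1" using le by simp
qed

text \<open>A third neighbour \<open>c\<close> of \<open>a\<close> lies in neither branch, so the
  union is not \<open>B\<close>. If the branches met, \<open>nbr_inter\<close> would give
  \<open>a\<close> a neighbour in both, which would equal \<open>b\<close> as well as
  \<open>b'\<close>. Once they are disjoint, the surplus of the union leaves room for only one
  common neighbour.\<close>

lemma branches_disjoint:
  assumes deg: "3 \<le> card (E `` {a})" and ne: "b \<noteq> b'"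
    and D: "D \<subseteq> B" "D \<inter> E `` {a} = {b}" "card (E\<inverse> `` D) \<le> card D + 1"
    and D': "D' \<subseteq> B" "D' \<inter> E `` {a} = {b'}" "card (E\<inverse> `` D') \<le> card D' + 1"
  shows "D \<inter> D' = {}" and "E\<inverse> `` D \<inter> E\<inverse> `` D' = {a}"
proof -
  have fin: "finite D" "finite D'" using D D' finB finite_subset by auto
  have "\<not> E `` {a} \<subseteq> {b, b'}"
    using deg card_mono[of "{b,b'}" "E `` {a}"] ne by auto
  then obtain c where c: "c \<in> E `` {a}" "c \<noteq> b" "c \<noteq> b'" by blast
  note bD = Int_Image_singletonD[OF D(2)] and bD' = Int_Image_singletonD[OF D'(2)]
  have un: "D \<union> D' \<noteq> B"
    using c bD(3) bD'(3) E_sub by blast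
  have a: "a \<in> E\<inverse> `` D \<inter> E\<inverse> `` D'" using bD(1,2) bD'(1,2) by blast
  show dis: "D \<inter> D' = {}"
  proof (rule ccontr)
    assume "D \<inter> D' \<noteq> {}"
    hence "a \<in> E\<inverse> `` (D \<inter> D')" using nbr_inter(1) D D' un a by metis
    thus False using bD(3) bD'(3) ne by blast
  qed
  have 1: "card (E\<inverse> `` D) + card (E\<inverse> `` D')
      = card (E\<inverse> `` (D \<union> D')) + card (E\<inverse> `` D \<inter> E\<inverse> `` D')"
    using card_Un_Int[of "E\<inverse> `` D" "E\<inverse> `` D'"] by (simp add: Image_Un)
  have 2: "card (D \<union> D') = card D + card D'"
    using fin dis by (rule card_Un_disjoint)
  have 3: "card (D \<union> D') < card (E\<inverse> `` (D \<union> D'))"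
    using D D' un by (intro surplus) auto
  have "card (E\<inverse> `` D \<inter> E\<inverse> `` D') \<le> card {a}"
    using 1 2 3 D D' by simp
  thus "E\<inverse> `` D \<inter> E\<inverse> `` D' = {a}"
    using a by (intro sym[OF card_seteq]) auto
qed

text \<open>Complementation exchanges the classes: the surplus of T comes from that of B - N(T),
  whose neighbours avoid T, and a branch D of the edge ab becomes the branch (A - N(D)) \<union> {a}
  at b.\<close>

lemma dual: "minimal_surplus B A (E\<inverse>)"
proof
  show "finite B" "finite A" "E\<inverse> \<subseteq> B \<times> A" "card B = card A" "2 \<le> card A"
    using finA finB E_sub card_eq card_ge2 by auto
next
  fix T assume T: "T \<subseteq> A" "T \<noteq> {}" "T \<noteq> A"
  have finT: "finite T" using T finA finite_subset by blast
  have lt: "card T < card A" using T finA by (simp add: psubset_card_mono psubsetI)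
  show "card T < card ((E\<inverse>)\<inverse> `` T)"
  proof (cases "E `` T = B")
    case True thus ?thesis using lt card_eq by simp
  next
    case False
    obtain a where a: "a \<in> T" using T by blast
    have "E `` {a} \<noteq> {}" using degA_ge2[of a] a T by force
    hence "B - E `` T \<noteq> B" using a nbrB by blast
    moreover have "B - E `` T \<noteq> {}" using False nbrB by blast
    ultimately have "card (B - E `` T) < card (E\<inverse> `` (B - E `` T))"
      by (intro surplus) auto
    also have "\<dots> \<le> card (A - T)" using nbrA finA by (intro card_mono) auto
    also have "\<dots> = card A - card T" using T finT by (simp add: card_Diff_subset)
    finally have "card B - card (E `` T) < card A - card T"
      using nbrB finB by (simp add: card_Diff_subset)
    thus ?thesis using card_eq by simp
  qed
next
  fix b a assume "(b, a) \<in> E\<inverse>"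
  hence ab: "(a, b) \<in> E" by simp
  from branchE[OF ab] obtain D
    where D: "D \<subseteq> B" "D \<inter> E `` {a} = {b}" "card (E\<inverse> `` D) \<le> card D + 1" .
  define T where "T = insert a (A - E\<inverse> `` D)"
  note bD = Int_Image_singletonD[OF D(2)]
  have finD: "finite D" using D finB finite_subset by blast
  have TA: "T \<subseteq> A" using ab E_sub by (auto simp: T_def)
  moreover have "T \<inter> E\<inverse> `` {b} = {a}"
    using bD(1) ab by (intro Int_Image_singletonI) (auto simp: T_def)
  moreover have "card (E `` T) \<le> card T + 1"
  proof -
    have "E `` T \<subseteq> insert b (B - D)" using bD(3) E_sub by (auto simp: T_def)
    hence "card (E `` T) \<le> card (insert b (B - D))" using finB by (intro card_mono) auto
    also have "\<dots> \<le> card (B - D) + 1" by (simp add: card_insert_le_m1 card_insert_if finB)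
    also have "card (B - D) = card B - card D" using D finD by (simp add: card_Diff_subset)
    finally have 1: "card (E `` T) \<le> card B - card D + 1" .
    have "a \<in> E\<inverse> `` D" using bD by blast
    hence "card T = card (A - E\<inverse> `` D) + 1" using finA by (simp add: T_def)
    also have "card (A - E\<inverse> `` D) = card A - card (E\<inverse> `` D)"
      using nbrA by (simp add: card_Diff_subset)
    finally show ?thesis using 1 D(3) card_eq by linarith
  qed
  ultimately show "\<exists>D\<subseteq>A. D \<inter> E\<inverse> `` {b} = {a} \<and> card ((E\<inverse>)\<inverse> `` D) \<le> card D + 1"
    by auto
qed

end

section \<open>Contracting a vertex of degree two\<close>

definition lowA :: "'a set \<Rightarrow> ('a \<times> 'b) set \<Rightarrow> 'a set" where
  "lowA A E = {a \<in> A. card (E `` {a}) = 2}"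

text \<open>The merged vertex keeps the name \<open>a1\<close>, so contraction stays within the same
  vertex type and leaves the class \<open>A - {a2}\<close>.\<close>

definition merge :: "'a \<Rightarrow> 'a \<Rightarrow> 'a \<Rightarrow> 'a" where
  "merge a1 a2 x = (if x = a2 then a1 else x)"

text \<open>The bicontraction of matching theory, meant for a vertex \<open>c\<close> whose
  neighbours are exactly \<open>a1\<close> and \<open>a2\<close>.\<close>

definition contract :: "'a \<Rightarrow> 'a \<Rightarrow> 'b \<Rightarrow> ('a \<times> 'b) set \<Rightarrow> ('a \<times> 'b) set" where
  "contract a1 a2 c E = {(merge a1 a2 a, b) | a b. (a, b) \<in> E \<and> b \<noteq> c}"

lemma card_merge_image:
  assumes "finite S" "a1 \<noteq> a2"
  shows "card (merge a1 a2 ` S) = (if a1 \<in> S \<and> a2 \<in> S then card S - 1 else card S)"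
proof (cases "a1 \<in> S \<and> a2 \<in> S")
  case True
  have "merge a1 a2 ` S = S - {a2}" using True assms by (auto simp: merge_def image_def)
  thus ?thesis using True assms by simp
next
  case False
  have "inj_on (merge a1 a2) S" using False by (auto simp: inj_on_def merge_def)
  hence "card (merge a1 a2 ` S) = card S" by (rule card_image)
  thus ?thesis using False by (simp only: if_False)
qed

context minimal_surplus
begin

context
  fixes a1 a2 :: 'a and c :: 'b
  assumes c: "c \<in> B" and nc: "E\<inverse> `` {c} = {a1, a2}" and a12: "a1 \<noteq> a2"
    and deg1: "3 \<le> card (E `` {a1})" and deg2: "3 \<le> card (E `` {a2})"
begin

text \<open>Having two neighbours, \<open>c\<close> forms a branch \<open>{c}\<close> by itself. A
  second common neighbour \<open>x\<close> would have a branch at \<open>a1\<close> sharing also the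
  neighbour \<open>a2\<close> with \<open>{c}\<close>, against
  \<open>branches_disjoint\<close>.\<close>

lemma contract_common_nbr: "E `` {a1} \<inter> E `` {a2} = {c}"
proof -
  have "x = c" if x: "(a1, x) \<in> E" "(a2, x) \<in> E" for x
  proof (rule ccontr)
    assume "x \<noteq> c"
    obtain D where D: "D \<subseteq> B" "D \<inter> E `` {a1} = {x}" "card (E\<inverse> `` D) \<le> card D + 1"
      by (rule branchE[OF x(1)])
    have "E\<inverse> `` D \<inter> E\<inverse> `` {c} = {a1}"
      using D c nc a12 \<open>x \<noteq> c\<close> by (intro branches_disjoint(2)[OF deg1, of x c]) auto
    moreover have "a2 \<in> E\<inverse> `` D" using Int_Image_singletonD(1)[OF D(2)] x by blast
    moreover have "a2 \<in> E\<inverse> `` {c}" by (simp add: nc)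
    ultimately have "a2 \<in> {a1}" by (metis IntI)
    thus False using a12 by simp
  qed
  thus ?thesis using nc by blast
qed

lemma contract_nbrs: "c \<notin> D \<Longrightarrow> (contract a1 a2 c E)\<inverse> `` D = merge a1 a2 ` (E\<inverse> `` D)"
  unfolding contract_def by blast

lemma contract_nbr_other:
  "a \<noteq> a1 \<Longrightarrow> a \<noteq> a2 \<Longrightarrow> contract a1 a2 c E `` {a} = E `` {a}"
  using nc by (fastforce simp: contract_def merge_def split: if_splits)

lemma contract_nbr_merged:
  "contract a1 a2 c E `` {a1} = E `` {a1} \<union> E `` {a2} - {c}"
proof -
  have "x \<in> contract a1 a2 c E `` {a1} \<longleftrightarrow> x \<in> E `` {a1} \<union> E `` {a2} - {c}" for x
    unfolding contract_def merge_def by auto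
  thus ?thesis by blast
qed

text \<open>As \<open>{c}\<close> is a branch at \<open>a\<close>, a branch \<open>D\<close> of
  another edge at \<open>a\<close> avoids \<open>c\<close> and has no neighbour in
  \<open>{a1, a2}\<close> except \<open>a\<close>. Hence \<open>D\<close> also serves the merged
  vertex.\<close>

lemma contract_branch:
  assumes x: "x \<noteq> c" "(a, x) \<in> E" and a: "a \<in> {a1, a2}"
  obtains D where "D \<subseteq> B - {c}" "D \<inter> (E `` {a1} \<union> E `` {a2} - {c}) = {x}"
    "card (merge a1 a2 ` (E\<inverse> `` D)) \<le> card D + 1"
proof -
  define a' where "a' = (if a = a1 then a2 else a1)"
  have aa: "{a, a'} = {a1, a2}" "a \<noteq> a'" using a a12 by (auto simp: a'_def)
  have deg: "3 \<le> card (E `` {a})" using a deg1 deg2 by auto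
  obtain D where D: "D \<subseteq> B" "D \<inter> E `` {a} = {x}" "card (E\<inverse> `` D) \<le> card D + 1"
    by (rule branchE[OF x(2)])
  have cc: "{c} \<inter> E `` {a} = {c}" using nc a by blast
  have "card (E\<inverse> `` {c}) \<le> card {c} + 1" using nc a12 by simp
  note dis = branches_disjoint[OF deg x(1) D _ cc this]
  have cD: "c \<notin> D" and "E\<inverse> `` D \<inter> E\<inverse> `` {c} = {a}" using dis c by auto
  moreover have "a' \<in> E\<inverse> `` {c}" using nc aa(1) by auto
  ultimately have "a' \<notin> E\<inverse> `` D" using aa(2) by (metis IntI singletonD)
  hence "D \<inter> E `` {a'} = {}" by blast
  moreover have "E `` {a1} \<union> E `` {a2} = E `` {a} \<union> E `` {a'}"
    using aa a by (auto simp: a'_def)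
  moreover have "D \<inter> {c} = {}" using cD by blast
  ultimately have "D \<inter> (E `` {a1} \<union> E `` {a2} - {c}) = {x}" using D(2) x(1) by (simp add: Int_Un_distrib Diff_Int_distrib)
  moreover have "card (merge a1 a2 ` (E\<inverse> `` D)) \<le> card D + 1"
    using card_image_le[of "E\<inverse> `` D" "merge a1 a2"] D(3) by auto
  ultimately show ?thesis using that[of D] D(1) cD by blast
qed

lemma contract_minimal_surplus: "minimal_surplus (A - {a2}) (B - {c}) (contract a1 a2 c E)"
proof -
  have aA: "a1 \<in> A" "a2 \<in> A" using nc E_sub by blast+
  have cB: "card (B - {c}) = card B - 1" using finB c by simp
  have "3 \<le> card B" using deg1 card_mono[OF finB nbrB[of "{a1}"]] by simp
  show ?thesis
  proof
    show "finite (A - {a2})" "finite (B - {c})" using finA finB by auto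
    show "contract a1 a2 c E \<subseteq> (A - {a2}) \<times> (B - {c})"
      using E_sub aA a12 by (auto simp: contract_def merge_def)
    show "card (A - {a2}) = card (B - {c})" using cB aA finA card_eq by simp
    show "2 \<le> card (B - {c})" using cB \<open>3 \<le> card B\<close> by simp
  next
    fix D assume D: "D \<subseteq> B - {c}" "D \<noteq> {}" "D \<noteq> B - {c}"
    hence cD: "c \<notin> D" by blast
    have finD: "finite D" using D finB finite_subset by blast
    have 1: "card D < card (E\<inverse> `` D)" using D c by (intro surplus) auto
    show "card D < card ((contract a1 a2 c E)\<inverse> `` D)"
    proof (cases "a1 \<in> E\<inverse> `` D \<and> a2 \<in> E\<inverse> `` D")
      \<comment> \<open>Here merging costs \<open>D\<close> a neighbour. Adding \<open>c\<close> to
        \<open>D\<close> brings no new neighbour, so the surplus of \<open>insert c D\<close>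
        supplies the missing one.\<close>
      case True
      moreover have "E\<inverse> `` (insert c D) = E\<inverse> `` {c} \<union> E\<inverse> `` D" by auto
      ultimately have "E\<inverse> `` (insert c D) = E\<inverse> `` D" using nc by auto
      moreover have "card (insert c D) < card (E\<inverse> `` insert c D)"
        using D c by (intro surplus) auto
      ultimately have "card D + 1 < card (E\<inverse> `` D)" using finD cD by simp
      thus ?thesis using True contract_nbrs[OF cD] card_merge_image[of "E\<inverse> `` D", OF _ a12] by simp
    next
      case False
      thus ?thesis using 1 contract_nbrs[OF cD] card_merge_image[of "E\<inverse> `` D", OF _ a12] by auto
    qed
  next
    fix a b assume ab: "(a, b) \<in> contract a1 a2 c E"
    hence bc: "b \<noteq> c" by (auto simp: contract_def)
    show "\<exists>D\<subseteq>B - {c}. D \<inter> contract a1 a2 c E `` {a} = {b} \<and>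
        card ((contract a1 a2 c E)\<inverse> `` D) \<le> card D + 1"
    proof (cases "a = a1")
      case True
      then obtain a' where "a' \<in> {a1, a2}" "(a', b) \<in> E"
        using ab by (auto simp: contract_def merge_def split: if_splits)
      then obtain D where D: "D \<subseteq> B - {c}" "D \<inter> (E `` {a1} \<union> E `` {a2} - {c}) = {b}"
        "card (merge a1 a2 ` (E\<inverse> `` D)) \<le> card D + 1"
        using contract_branch bc by blast
      moreover have "c \<notin> D" using D by blast
      ultimately show ?thesis using True contract_nbr_merged contract_nbrs by metis
    next
      case False
      have a2: "a \<noteq> a2" using ab a12 by (auto simp: contract_def merge_def split: if_splits)
      hence eq: "contract a1 a2 c E `` {a} = E `` {a}" using False contract_nbr_other by simp
      hence "(a, b) \<in> E" using ab by blast
      from branchE[OF this] obtain D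
        where D: "D \<subseteq> B" "D \<inter> E `` {a} = {b}" "card (E\<inverse> `` D) \<le> card D + 1" .
      have finD: "finite D" using D finB finite_subset by blast
      have "c \<notin> E `` {a}" using nc False a2 by blast
      hence "(D - {c}) \<inter> E `` {a} = {b}" using D(2) bc by (simp add: Diff_Int_distrib2)
      \<comment> \<open>If the branch contains \<open>c\<close>, dropping \<open>c\<close> costs an
        element, but then \<open>a1\<close> and \<open>a2\<close> are both neighbours and merging
        them saves one.\<close>
      moreover have "card (merge a1 a2 ` (E\<inverse> `` (D - {c}))) \<le> card (D - {c}) + 1"
      proof (cases "c \<in> D")
        case True
        have "card (merge a1 a2 ` (E\<inverse> `` (D - {c}))) \<le> card (merge a1 a2 ` (E\<inverse> `` D))"
          by (intro card_mono image_mono Image_mono) auto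
        also have "\<dots> = card (E\<inverse> `` D) - 1"
          using True nc card_merge_image[of "E\<inverse> `` D", OF _ a12] by auto
        finally show ?thesis using D(3) True finD by (simp add: card_Diff_singleton)
      next
        case False
        thus ?thesis using card_image_le[of "E\<inverse> `` D" "merge a1 a2"] D(3) by simp
      qed
      moreover have "(contract a1 a2 c E)\<inverse> `` (D - {c}) = merge a1 a2 ` (E\<inverse> `` (D - {c}))"
        by (rule contract_nbrs) simp
      moreover have "D - {c} \<subseteq> B - {c}" using D(1) by blast
      ultimately show ?thesis unfolding eq by (intro exI[of _ "D - {c}"]) simp
    qed
  qed
qed

text \<open>Only \<open>c\<close> is adjacent to both \<open>a1\<close> and \<open>a2\<close>, so no
  other vertex of \<open>B\<close> loses a neighbour by merging.\<close>

lemma contract_degB: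
  assumes "b \<noteq> c" shows "card ((contract a1 a2 c E)\<inverse> `` {b}) = card (E\<inverse> `` {b})"
proof -
  have "\<not> (a1 \<in> E\<inverse> `` {b} \<and> a2 \<in> E\<inverse> `` {b})" using contract_common_nbr assms by blast
  thus ?thesis using contract_nbrs[of "{b}"] assms card_merge_image[of "E\<inverse> `` {b}", OF _ a12] by auto
qed

lemma contract_lowB: "lowA (B - {c}) ((contract a1 a2 c E)\<inverse>) = lowA B (E\<inverse>) - {c}"
  unfolding lowA_def using contract_degB by fastforce

text \<open>The merged vertex has degree |N(a1)| + |N(a2)| - 2, which is at least four, and neither
  \<open>a1\<close> nor \<open>a2\<close> was low before.\<close>

lemma contract_lowA: "lowA (A - {a2}) (contract a1 a2 c E) = lowA A E"
proof -
  have "card (E `` {a1} \<union> E `` {a2}) + 1 = card (E `` {a1}) + card (E `` {a2})"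
    using card_Un_Int[of "E `` {a1}" "E `` {a2}"] by (simp add: contract_common_nbr)
  hence "card (E `` {a1} \<union> E `` {a2} - {c}) \<noteq> 2"
    using deg1 deg2 contract_common_nbr by (subst card_Diff_singleton) auto
  hence "card (contract a1 a2 c E `` {a1}) \<noteq> 2" by (simp add: contract_nbr_merged)
  note merged = this
  have other: "a \<in> A - {a2} \<and> card (contract a1 a2 c E `` {a}) = 2 \<longleftrightarrow> a \<in> A \<and> card (E `` {a}) = 2"
    if "a \<noteq> a1" for a
    using that deg2 contract_nbr_other[of a] by (cases "a = a2") auto
  have "a \<in> A - {a2} \<and> card (contract a1 a2 c E `` {a}) = 2 \<longleftrightarrow> a \<in> A \<and> card (E `` {a}) = 2" for a
  proof (cases "a = a1")
    case True thus ?thesis using merged deg1 by simp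
  next
    case False thus ?thesis by (rule other)
  qed
  thus ?thesis unfolding lowA_def by (rule Collect_cong)
qed

text \<open>Only the two edges at \<open>c\<close> vanish; by \<open>contract_common_nbr\<close>,
  merging identifies no others. Since each class also loses one vertex, m - n is unchanged.\<close>

lemma contract_card: "card (contract a1 a2 c E) + 2 = card E"
proof -
  let ?E = "{(a, b) \<in> E. b \<noteq> c}"
  have "contract a1 a2 c E = (\<lambda>(a, b). (merge a1 a2 a, b)) ` ?E"
    unfolding contract_def by (simp add: set_eq_iff image_iff) blast
  moreover have "inj_on (\<lambda>(a, b). (merge a1 a2 a, b)) ?E"
  proof -
    have "b = c" if "(a1, b) \<in> E" "(a2, b) \<in> E" for b
      using that contract_common_nbr by (metis IntI Image_singleton_iff singletonD)
    thus ?thesis unfolding inj_on_def merge_def by (auto split: if_splits)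
  qed
  ultimately have 1: "card (contract a1 a2 c E) = card ?E" by (simp add: card_image)
  have "a = a1 \<or> a = a2" if "(a, c) \<in> E" for a using that nc by (metis Image_singleton_iff converse_iff insertE singletonD)
  moreover have "(a1, c) \<in> E" "(a2, c) \<in> E" using nc by auto
  ultimately have "E = ?E \<union> {(a1, c), (a2, c)}" by auto
  hence "card E = card (?E \<union> {(a1, c), (a2, c)})" by (rule arg_cong)
  also have "\<dots> = card ?E + 2" using finE a12
    by (subst card_Un_disjoint) (auto intro: finite_subset[OF _ finE])
  finally show ?thesis using 1 by simp
qed

end

section \<open>A lower bound on the number of vertices of degree two\<close>

lemma card_E: "card E = (\<Sum>a\<in>A. card (E `` {a}))"
proof -
  have "E = Sigma A (\<lambda>a. E `` {a})" using E_sub by auto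
  hence "card E = card (SIGMA a:A. E `` {a})" by (rule arg_cong)
  thus ?thesis using finA by simp
qed

text \<open>By \<open>irr\<close> no contraction is possible. With \<open>H\<close> the vertices of
  degree at least three, the claim reduces to: the degree sum over \<open>H\<close> plus 2 is at
  most |B| + |H|. Each vertex of \<open>H\<close> gives up at most one neighbour, one of them gives
  up none, and the sets of kept neighbours are disjoint and miss a root.\<close>

lemma low_count_irreducible:
  assumes irr: "\<And>b a a'. b \<in> B \<Longrightarrow> E\<inverse> `` {b} = {a, a'} \<Longrightarrow> a \<noteq> a' \<Longrightarrow>
    3 \<le> card (E `` {a}) \<Longrightarrow> 3 \<le> card (E `` {a'}) \<Longrightarrow> False"
  shows "card E + 2 \<le> card (lowA A E) + 2 * card A"
proof -
  define H where "H = {a \<in> A. 3 \<le> card (E `` {a})}"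
  have "card (E `` {a}) = 2 \<or> 3 \<le> card (E `` {a})" if "a \<in> A" for a
    using degA_ge2[OF that] by linarith
  hence AH: "A = lowA A E \<union> H" "lowA A E \<inter> H = {}"
    unfolding H_def lowA_def by auto
  have finH: "finite H" "finite (lowA A E)" using finA by (auto simp: H_def lowA_def)
  have cA: "card A = card (lowA A E) + card H"
    using card_Un_disjoint[OF finH(2,1) AH(2)] unfolding AH(1)[symmetric] .
  have "card E = (\<Sum>a\<in>lowA A E \<union> H. card (E `` {a}))" unfolding AH(1)[symmetric] by (rule card_E)
  also have "\<dots> = (\<Sum>a\<in>lowA A E. card (E `` {a})) + (\<Sum>a\<in>H. card (E `` {a}))"
    using AH(2) finH by (intro sum.union_disjoint) auto
  also have "(\<Sum>a\<in>lowA A E. card (E `` {a})) = 2 * card (lowA A E)"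
    by (simp add: lowA_def)
  finally have cE: "card E = 2 * card (lowA A E) + (\<Sum>a\<in>H. card (E `` {a}))" .
  show ?thesis
  proof (cases "H = {}")
    case True thus ?thesis using cE cA card_eq card_ge2 by simp
  next
    case False
    then obtain a0 where a0: "a0 \<in> H" by blast
    have "\<forall>p. \<exists>D. p \<in> E \<longrightarrow> D \<subseteq> B \<and> D \<inter> E `` {fst p} = {snd p} \<and> card (E\<inverse> `` D) \<le> card D + 1"
      using minimal by fastforce
    then obtain X0 where X0: "\<forall>p. p \<in> E \<longrightarrow>
      X0 p \<subseteq> B \<and> X0 p \<inter> E `` {fst p} = {snd p} \<and> card (E\<inverse> `` X0 p) \<le> card (X0 p) + 1"
      by metis
    define X where "X a b = X0 (a, b)" for a b
    have X: "X a b \<subseteq> B" "X a b \<inter> E `` {a} = {b}" "card (E\<inverse> `` X a b) \<le> card (X a b) + 1"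
      if "(a, b) \<in> E" for a b using X0 that by (auto simp: X_def)
    have dis: "X a b \<inter> X a b' = {}" "E\<inverse> `` X a b \<inter> E\<inverse> `` X a b' = {a}"
      if "a \<in> H" "(a, b) \<in> E" "(a, b') \<in> E" "b \<noteq> b'" for a b b'
      using branches_disjoint[of a b b' "X a b" "X a b'"] X that by (auto simp: H_def)
    have finX: "finite (X a b)" if "(a, b) \<in> E" for a b
      using X(1)[OF that] finB finite_subset by blast
    \<comment> \<open>The branches at \<open>a0\<close> do not cover \<open>B\<close>: each has at
      most as many elements as it has neighbours besides \<open>a0\<close>, and these neighbour sets
      are disjoint inside \<open>A - {a0}\<close>, which is smaller than \<open>B\<close>.\<close>
    obtain r where r: "r \<in> B" "\<And>b. (a0, b) \<in> E \<Longrightarrow> r \<notin> X a0 b"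
    proof -
      let ?N = "E `` {a0}"
      have "card (X a0 b) \<le> card (E\<inverse> `` X a0 b - {a0})" if b: "b \<in> ?N" for b
      proof -
        have "a0 \<in> E\<inverse> `` X a0 b" using X(2)[of a0 b] b by blast
        moreover have "card (X a0 b) < card (E\<inverse> `` X a0 b)"
        proof (rule surplus)
          show "X a0 b \<noteq> B"
          proof
            assume "X a0 b = B"
            hence "?N = {b}" using X(2)[of a0 b] b nbrB[of "{a0}"] by blast
            thus False using a0 by (simp add: H_def)
          qed
        qed (use X[of a0 b] b in auto)
        ultimately show ?thesis by simp
      qed
      hence "(\<Sum>b\<in>?N. card (X a0 b)) \<le> (\<Sum>b\<in>?N. card (E\<inverse> `` X a0 b - {a0}))"
        by (rule sum_mono)
      also have "\<dots> = card (\<Union>b\<in>?N. E\<inverse> `` X a0 b - {a0})"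
      proof (rule card_UN_disjoint[symmetric])
        show "\<forall>b\<in>?N. \<forall>b'\<in>?N. b \<noteq> b' \<longrightarrow>
            (E\<inverse> `` X a0 b - {a0}) \<inter> (E\<inverse> `` X a0 b' - {a0}) = {}"
        proof (intro ballI impI)
          fix b b' assume "b \<in> ?N" "b' \<in> ?N" "b \<noteq> b'"
          hence "E\<inverse> `` X a0 b \<inter> E\<inverse> `` X a0 b' = {a0}" by (intro dis(2)[OF a0]) auto
          thus "(E\<inverse> `` X a0 b - {a0}) \<inter> (E\<inverse> `` X a0 b' - {a0}) = {}" by blast
        qed
      qed auto
      also have "\<dots> \<le> card (A - {a0})"
        using nbrA finA by (intro card_mono) blast+
      also have "\<dots> < card A"
        using a0 finA by (intro card_Diff1_less) (auto simp: H_def)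
      finally have "(\<Sum>b\<in>?N. card (X a0 b)) < card B" using card_eq by simp
      hence "card (\<Union>b\<in>?N. X a0 b) < card B"
        using card_UN_le[of ?N "X a0"] by simp
      hence "(\<Union>b\<in>?N. X a0 b) \<noteq> B" by auto
      moreover have "(\<Union>b\<in>?N. X a0 b) \<subseteq> B" using X(1) by blast
      ultimately show ?thesis using that by blast
    qed
    \<comment> \<open>Root \<open>B\<close> at \<open>r\<close>. An edge \<open>ab\<close> whose branch avoids \<open>r\<close> leads away from the root; a vertex \<open>b\<close> is
      reached by at most one such edge, and \<open>r\<close> was chosen so that all edges at \<open>a0\<close> are of this kind.\<close>
    define K where "K a = {b \<in> E `` {a}. r \<notin> X a b}" for a
    have finK: "finite (K a)" for a unfolding K_def by (rule finite_subset[OF Collect_restrict fin_nbrB])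
    have Kdis: "K a \<inter> K a' = {}" if aa: "a \<in> H" "a' \<in> H" "a \<noteq> a'" for a a'
    proof (rule ccontr)
      assume "K a \<inter> K a' \<noteq> {}"
      then obtain b where b: "(a, b) \<in> E" "(a', b) \<in> E" "r \<notin> X a b" "r \<notin> X a' b"
        by (auto simp: K_def)
      \<comment> \<open>Both branches miss \<open>r\<close>, so \<open>nbr_inter\<close> applies to
        their intersection \<open>Z\<close>. Both \<open>a\<close> and \<open>a'\<close> meet
        \<open>Z\<close> only in \<open>b\<close>; removing \<open>b\<close> thus loses two
        neighbours and contradicts the surplus unless \<open>Z = {b}\<close>. Then \<open>b\<close>
        has degree two with both neighbours in \<open>H\<close>, against \<open>irr\<close>.\<close>
      define Z where "Z = X a b \<inter> X a' b"
      have bZ: "b \<in> Z" using X(2) b by (auto simp: Z_def)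
      have cZ: "card (E\<inverse> `` Z) \<le> card Z + 1"
        unfolding Z_def using b X bZ r(1) by (intro nbr_inter(2)) (auto simp: Z_def)
      have ZB: "Z \<subseteq> B" "r \<notin> Z" using X(1) b by (auto simp: Z_def)
      have finZ: "finite Z" using ZB finB finite_subset by blast
      have "E\<inverse> `` (Z - {b}) \<subseteq> E\<inverse> `` Z - {a, a'}"
        using X(2) b by (fastforce simp: Z_def)
      hence "card (E\<inverse> `` (Z - {b})) \<le> card (E\<inverse> `` Z - {a, a'})" by (intro card_mono) auto
      also have "\<dots> = card (E\<inverse> `` Z) - 2"
        using bZ b aa by (subst card_Diff_subset) auto
      finally have le: "card (E\<inverse> `` (Z - {b})) \<le> card (Z - {b})"
        using cZ bZ finZ by simp
      have "Z = {b}"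
      proof (rule ccontr)
        assume "Z \<noteq> {b}"
        hence "card (Z - {b}) < card (E\<inverse> `` (Z - {b}))"
          using bZ ZB r(1) by (intro surplus) auto
        thus False using le by simp
      qed
      hence "card (E\<inverse> `` {b}) \<le> card {a, a'}" using cZ aa by simp
      hence "E\<inverse> `` {b} = {a, a'}" using b by (intro sym[OF card_seteq]) auto
      thus False using irr[of b a a'] aa bZ ZB by (auto simp: H_def)
    qed
    have Kge: "card (E `` {a}) \<le> card (K a) + 1" if a: "a \<in> H" for a
    proof -
      \<comment> \<open>The branches at \<open>a\<close> are disjoint, so at most one of them
        contains \<open>r\<close>.\<close>
      have "card {b \<in> E `` {a}. r \<in> X a b} \<le> Suc 0"
        unfolding card_le_Suc0_iff_eq[OF finite_subset[OF Collect_restrict fin_nbrB]]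
        using dis(1)[OF a] by blast
      moreover have "card (E `` {a}) = card (K a \<union> {b \<in> E `` {a}. r \<in> X a b})"
        by (rule arg_cong[where f=card]) (auto simp: K_def)
      ultimately show ?thesis using card_Un_le[of "K a" "{b \<in> E `` {a}. r \<in> X a b}"] by linarith
    qed
    have "K a0 = E `` {a0}" using r(2) by (auto simp: K_def)
    moreover have "(\<Sum>a\<in>H - {a0}. card (E `` {a})) \<le> (\<Sum>a\<in>H - {a0}. card (K a) + 1)"
      using Kge by (intro sum_mono) auto
    \<comment> \<open>The extra one on the left comes from \<open>a0\<close>, which keeps all its
      neighbours.\<close>
    ultimately have "(\<Sum>a\<in>H. card (E `` {a})) + 1 \<le> (\<Sum>a\<in>H. card (K a) + 1)"
      using a0 finH by (simp add: sum.remove[of H a0])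
    also have "\<dots> = (\<Sum>a\<in>H. card (K a)) + card H" by (simp add: sum_Suc)
    also have "(\<Sum>a\<in>H. card (K a)) = card (\<Union>a\<in>H. K a)"
      using Kdis finH finK by (intro card_UN_disjoint[symmetric]) auto
    also have "\<dots> \<le> card (B - {r})"
    proof (intro card_mono)
      show "(\<Union>a\<in>H. K a) \<subseteq> B - {r}"
        using X(2) nbrB by (fastforce simp: K_def)
    qed (use finB in auto)
    also have "card (B - {r}) = card B - 1" using r(1) finB by simp
    finally have "(\<Sum>a\<in>H. card (E `` {a})) + 2 \<le> card B + card H"
      using card_ge2 by linarith
    thus ?thesis using cE cA card_eq by linarith
  qed
qed

end

text \<open>With n = 2 |A| the bound says that \<open>lowA A E\<close> has at least m - n + 2
  elements. Contraction lowers both sides by two, so induction on |B| ends in the irreducible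
  case.\<close>

theorem low_count:
  assumes "minimal_surplus A B E"
  shows "card E + 2 \<le> card (lowA A E) + 2 * card A"
  using assms
proof (induction "card B" arbitrary: A B E rule: less_induct)
  case less
  interpret minimal_surplus A B E by (rule less.prems)
  show ?case
  proof (cases "\<exists>c a1 a2. c \<in> B \<and> E\<inverse> `` {c} = {a1, a2} \<and> a1 \<noteq> a2 \<and>
      3 \<le> card (E `` {a1}) \<and> 3 \<le> card (E `` {a2})")
    case True
    then obtain c a1 a2 where c: "c \<in> B" "E\<inverse> `` {c} = {a1, a2}" "a1 \<noteq> a2"
      "3 \<le> card (E `` {a1})" "3 \<le> card (E `` {a2})" by blast
    have "a2 \<in> A" using c E_sub by blast
    have "card (contract a1 a2 c E) + 2
        \<le> card (lowA (A - {a2}) (contract a1 a2 c E)) + 2 * card (A - {a2})"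
      using c finB by (intro less.hyps[OF _ contract_minimal_surplus[OF c]] card_Diff1_less)
    thus ?thesis using contract_card[OF c] contract_lowA[OF c] finA \<open>a2 \<in> A\<close> card_eq card_ge2
      by simp
  next
    case False
    thus ?thesis by (intro low_count_irreducible) blast
  qed
qed

context minimal_surplus
begin

text \<open>With k = m - n + 2, \<open>ext\<close> allows at most 2k low vertices. If both
  neighbours of \<open>b\<close> had degree at least three, contraction would keep k and
  \<open>lowA A E\<close> but remove \<open>b\<close> from the low vertices of \<open>B\<close>;
  \<open>low_count\<close> in both classes of the contraction would then force 2k + 1 low vertices
  before it.\<close>

lemma extremal_low_nbr:
  assumes ext: "card (lowA A E) + card (lowA B (E\<inverse>)) + 4 * card A \<le> 2 * card E + 4"
    and b: "b \<in> lowA B (E\<inverse>)"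
  shows "\<exists>a\<in>lowA A E. (a, b) \<in> E"
proof (rule ccontr)
  assume no: "\<not> ?thesis"
  obtain a1 a2 where a: "E\<inverse> `` {b} = {a1, a2}" "a1 \<noteq> a2" and bB: "b \<in> B"
    using b by (auto simp: lowA_def card_2_iff)
  have aA: "a1 \<in> A" "a2 \<in> A" using a E_sub by blast+
  have "3 \<le> card (E `` {x})" if "x \<in> {a1, a2}" for x
  proof -
    have "(x, b) \<in> E" using a that by blast
    hence "card (E `` {x}) \<noteq> 2" using no aA that by (auto simp: lowA_def)
    thus ?thesis using degA_ge2[of x] aA that by fastforce
  qed
  hence c: "b \<in> B" "E\<inverse> `` {b} = {a1, a2}" "a1 \<noteq> a2"
      "3 \<le> card (E `` {a1})" "3 \<le> card (E `` {a2})" using a bB by auto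
  interpret C: minimal_surplus "A - {a2}" "B - {b}" "contract a1 a2 b E"
    by (rule contract_minimal_surplus[OF c])
  have "card (lowA B (E\<inverse>) - {b}) < card (lowA B (E\<inverse>))"
    using b finB by (intro card_Diff1_less) (auto simp: lowA_def)
  moreover have "card (A - {a2}) + 1 = card A" using aA finA card_eq card_ge2 by simp
  moreover have "card (B - {b}) + 1 = card B" using bB finB card_eq card_ge2 by simp
  moreover have "card (contract a1 a2 b E) + 2 \<le> card (lowA A E) + 2 * card (A - {a2})"
    using low_count[OF C.minimal_surplus_axioms] contract_lowA[OF c] by simp
  moreover have "card (contract a1 a2 b E) + 2 \<le> card (lowA B (E\<inverse>) - {b}) + 2 * card (B - {b})"
    using low_count[OF C.dual] contract_lowB[OF c] by (simp add: card_inverse)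
  ultimately show False using ext contract_card[OF c] card_eq by linarith
qed

end

section \<open>Hall's theorem and matching covered bipartite graphs\<close>

text \<open>The Halmos-Vaughan induction. If some nonempty proper subfamily \<open>K\<close> is
  tight, choose representatives for \<open>K\<close> and for the rest separately; otherwise every
  such subfamily has slack, and any element may represent any index.\<close>

theorem hall_marriage:
  fixes F :: "'i \<Rightarrow> 'a set"
  assumes "finite I" and "\<And>i. i \<in> I \<Longrightarrow> finite (F i)"
    and "\<And>J. J \<subseteq> I \<Longrightarrow> card J \<le> card (\<Union> (F ` J))"
  shows "\<exists>s. inj_on s I \<and> (\<forall>i\<in>I. s i \<in> F i)"
  using assms
proof (induction "card I" arbitrary: I F rule: less_induct)
  case less
  have finU: "finite (\<Union> (F ` J))" if "J \<subseteq> I" for J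
    using less.prems(1,2) that finite_subset by blast
  show ?case
  proof (cases "\<exists>J. J \<subset> I \<and> J \<noteq> {} \<and> card (\<Union> (F ` J)) \<le> card J")
    case True
    then obtain K where K: "K \<subset> I" "K \<noteq> {}" "card (\<Union> (F ` K)) \<le> card K" by blast
    define U where "U = \<Union> (F ` K)"
    have finK: "finite K" using K less.prems(1) finite_subset by blast
    have finU': "finite U" using finU[of K] K by (auto simp: U_def)
    have "\<exists>s. inj_on s K \<and> (\<forall>i\<in>K. s i \<in> F i)"
      using K less.prems by (intro less.hyps psubset_card_mono) (auto intro: finK)
    then obtain s where s: "inj_on s K" "\<forall>i\<in>K. s i \<in> F i" by blast
    have "\<exists>t. inj_on t (I - K) \<and> (\<forall>i\<in>I - K. t i \<in> F i - U)"
    proof (rule less.hyps)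
      show "card (I - K) < card I"
        using K less.prems(1) by (intro psubset_card_mono) auto
    next
      fix J assume J: "J \<subseteq> I - K"
      have finJ: "finite J" using J less.prems(1) finite_subset by blast
      \<comment> \<open>Hall's condition survives the removal of \<open>U\<close>: compare with
        \<open>J \<union> K\<close> and use that \<open>U\<close> has at most |K| elements.\<close>
      have "card J + card K = card (J \<union> K)"
        using J finJ finK by (subst card_Un_disjoint) auto
      also have "\<dots> \<le> card (\<Union> (F ` (J \<union> K)))" using J K by (intro less.prems(3)) auto
      also have "\<Union> (F ` (J \<union> K)) = \<Union> ((\<lambda>i. F i - U) ` J) \<union> U" by (auto simp: U_def)
      also have "card \<dots> \<le> card (\<Union> ((\<lambda>i. F i - U) ` J)) + card U" by (rule card_Un_le)
      also have "\<dots> \<le> card (\<Union> ((\<lambda>i. F i - U) ` J)) + card K" using K by (simp add: U_def)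
      finally show "card J \<le> card (\<Union> ((\<lambda>i. F i - U) ` J))" by simp
    qed (use less.prems in auto)
    then obtain t where t: "inj_on t (I - K)" "\<forall>i\<in>I - K. t i \<in> F i - U" by blast
    have "inj_on (\<lambda>i. if i \<in> K then s i else t i) I"
      using s t unfolding inj_on_def U_def by (smt (verit) DiffE DiffI UN_I)
    moreover have "\<forall>i\<in>I. (if i \<in> K then s i else t i) \<in> F i" using s t by auto
    ultimately show ?thesis by blast
  next
    case False
    show ?thesis
    proof (cases "I = {}")
      case True thus ?thesis by simp
    next
      case ne: False
      then obtain i where i: "i \<in> I" by blast
      have "F i \<noteq> {}" using less.prems(3)[of "{i}"] i by auto
      then obtain x where x: "x \<in> F i" by blast
      have "\<exists>s. inj_on s (I - {i}) \<and> (\<forall>j\<in>I - {i}. s j \<in> F j - {x})"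
      proof (rule less.hyps)
        show "card (I - {i}) < card I" using i less.prems(1) by (rule card_Diff1_less[rotated])
      next
        fix J assume J: "J \<subseteq> I - {i}"
        show "card J \<le> card (\<Union> ((\<lambda>j. F j - {x}) ` J))"
        proof (cases "J = {}")
          case False': False
          have "\<not> card (\<Union> (F ` J)) \<le> card J" using False False' J i by blast
          moreover have "\<Union> ((\<lambda>j. F j - {x}) ` J) = \<Union> (F ` J) - {x}" by blast
          moreover have "card (\<Union> (F ` J)) - 1 \<le> card (\<Union> (F ` J) - {x})"
            by (simp add: card_Diff_singleton_if)
          ultimately show ?thesis by simp
        qed simp
      qed (use less.prems in auto)
      then obtain s where s: "inj_on s (I - {i})" "\<forall>j\<in>I - {i}. s j \<in> F j - {x}" by blast
      have "inj_on (s(i := x)) I" using s unfolding inj_on_def by auto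
      moreover have "\<forall>j\<in>I. (s(i := x)) j \<in> F j" using s x by auto
      ultimately show ?thesis by blast
    qed
  qed
qed

section \<open>Bipartite multigraphs and their arc relations\<close>

definition arcs :: "'v set \<Rightarrow> 'v set \<Rightarrow> ('v, 'e) mgraph \<Rightarrow> ('v \<times> 'v) set" where
  "arcs A B G = {(a, b). a \<in> A \<and> b \<in> B \<and> (\<exists>e\<in>edges G. ends G e = {a, b})}"

locale bipartite_multigraph =
  fixes G :: "('v, 'e) mgraph" and A B :: "'v set"
  assumes multi: "multigraph G" and verts_eq: "verts G = A \<union> B" and disj: "A \<inter> B = {}"
    and edge_parts: "\<And>e. e \<in> edges G \<Longrightarrow> \<exists>a\<in>A. \<exists>b\<in>B. ends G e = {a, b}"
begin

lemma finite_parts: "finite A" "finite B" "finite (edges G)"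
  using multi verts_eq by (auto simp: multigraph_def)

lemma arcs_sub: "arcs A B G \<subseteq> A \<times> B"
  by (auto simp: arcs_def)

lemma finite_arcs_nbr: "finite ((arcs A B G)\<inverse> `` D)"
  by (rule finite_subset[OF _ finite_parts(1)]) (use arcs_sub in auto)

lemma edge_arc:
  assumes "e \<in> edges G"
  obtains a b where "a \<in> A" "b \<in> B" "ends G e = {a, b}" "(a, b) \<in> arcs A B G"
  using edge_parts[OF assms] assms by (auto simp: arcs_def)

lemma pair_eq_iff:
  "a \<in> A \<Longrightarrow> b \<in> B \<Longrightarrow> a' \<in> A \<Longrightarrow> b' \<in> B \<Longrightarrow> {a, b} = {a', b'} \<longleftrightarrow> a = a' \<and> b = b'"
  using disj by (auto simp: doubleton_eq_iff)

lemma not_both: "x \<in> A \<Longrightarrow> x \<in> B \<Longrightarrow> False"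
  using disj by blast

lemma swap: "bipartite_multigraph G B A"
  using multi verts_eq disj edge_parts by unfold_locales (auto, metis insert_commute)

lemma arcs_swap: "arcs B A G = (arcs A B G)\<inverse>"
  unfolding arcs_def by (auto simp: insert_commute)

lemma delete: "bipartite_multigraph (delete_edge G e) A B"
  using multi verts_eq disj edge_parts
  by unfold_locales (auto simp: delete_edge_def multigraph_def)

text \<open>Turns a set of edges into a bijection along arcs, so that cardinalities can be compared;
  the second property pins the partner across a prescribed matching edge.\<close>

lemma perfect_matching_bij:
  assumes M: "perfect_matching G M"
  obtains p where "bij_betw p B A"
    and "\<And>e a b. e \<in> M \<Longrightarrow> a \<in> A \<Longrightarrow> b \<in> B \<Longrightarrow> ends G e = {a, b} \<Longrightarrow> p b = a"
    and "\<And>b. b \<in> B \<Longrightarrow> (p b, b) \<in> arcs A B G"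
proof -
  have ME: "M \<subseteq> edges G" and uniq: "\<And>e e' v. v \<in> A \<union> B \<Longrightarrow> e \<in> M \<Longrightarrow> e' \<in> M \<Longrightarrow>
      v \<in> ends G e \<Longrightarrow> v \<in> ends G e' \<Longrightarrow> e = e'"
    and ex: "\<And>v. v \<in> A \<union> B \<Longrightarrow> \<exists>e\<in>M. v \<in> ends G e"
    using M unfolding perfect_matching_def verts_eq by blast+
  have "\<exists>a e. e \<in> M \<and> a \<in> A \<and> ends G e = {a, b}" if b: "b \<in> B" for b
  proof -
    obtain e where e: "e \<in> M" "b \<in> ends G e" using ex b by blast
    obtain a b' where ab: "a \<in> A" "b' \<in> B" "ends G e = {a, b'}"
      using edge_parts[of e] e ME by auto
    hence "b = b'" using e b not_both by auto
    thus ?thesis using e ab by blast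
  qed
  then obtain p f where pf: "\<And>b. b \<in> B \<Longrightarrow> f b \<in> M \<and> p b \<in> A \<and> ends G (f b) = {p b, b}"
    by metis
  have det: "p b = a" if "e \<in> M" "a \<in> A" "b \<in> B" "ends G e = {a, b}" for e a b
  proof -
    have "f b = e" using that pf[of b] by (intro uniq[of b]) auto
    thus ?thesis using pf[of b] that pair_eq_iff by metis
  qed
  have "inj_on p B"
  proof (rule inj_onI)
    fix b b' assume b: "b \<in> B" "b' \<in> B" "p b = p b'"
    have "f b = f b'" using b pf[of b] pf[of b'] by (intro uniq[of "p b"]) auto
    thus "b = b'" using pf b pair_eq_iff by metis
  qed
  moreover have "p ` B = A"
  proof (intro equalityI subsetI)
    fix a assume a: "a \<in> A"
    obtain e where e: "e \<in> M" "a \<in> ends G e" using ex a by blast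
    obtain a' b where ab: "a' \<in> A" "b \<in> B" "ends G e = {a', b}"
      using edge_parts[of e] e ME by auto
    hence "a' = a" using e a not_both by auto
    hence "p b = a" using det e ab by blast
    thus "a \<in> p ` B" using ab by blast
  qed (use pf in auto)
  moreover have "(p b, b) \<in> arcs A B G" if "b \<in> B" for b
    using pf[OF that] that ME by (auto simp: arcs_def)
  ultimately show ?thesis using that[of p] det by (auto simp: bij_betw_def)
qed

text \<open>Induction along a path. A path may traverse an arc in either direction, hence the
  equivalence in \<open>cl\<close>.\<close>

lemma closed_set_connected:
  assumes con: "connected_graph G" and x: "x \<in> S" "x \<in> verts G"
    and cl: "\<And>a b. (a, b) \<in> arcs A B G \<Longrightarrow> a \<in> S \<longleftrightarrow> b \<in> S"
  shows "verts G \<subseteq> S"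
proof
  fix y assume y: "y \<in> verts G"
  hence "(x, y) \<in> (adjacency G)\<^sup>*" using con x by (auto simp: connected_graph_def)
  thus "y \<in> S"
  proof (induction rule: rtrancl_induct)
    case (step u v)
    then obtain e where e: "e \<in> edges G" "ends G e = {u, v}" by (auto simp: adjacency_def)
    then obtain a b where "ends G e = {a, b}" "(a, b) \<in> arcs A B G" using edge_arc by metis
    thus ?case using e cl step.IH by (metis doubleton_eq_iff)
  qed (use x in auto)
qed

lemma matching_covered_parts:
  assumes mc: "matching_covered G"
  shows "card A = card B" and "2 \<le> card B"
    and "\<And>D. D \<subseteq> B \<Longrightarrow> D \<noteq> {} \<Longrightarrow> D \<noteq> B \<Longrightarrow> card D < card ((arcs A B G)\<inverse> `` D)"
proof -
  have con: "connected_graph G" and c4: "4 \<le> card (verts G)"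
    and cov: "\<And>e. e \<in> edges G \<Longrightarrow> \<exists>M. perfect_matching G M \<and> e \<in> M"
    using mc by (auto simp: matching_covered_def)
  have cV: "card (verts G) = card A + card B"
    unfolding verts_eq using finite_parts disj by (simp add: card_Un_disjoint)
  obtain e where e: "e \<in> edges G"
  proof -
    obtain x where x: "x \<in> verts G" using con by (auto simp: connected_graph_def)
    have "edges G \<noteq> {}"
    proof
      assume "edges G = {}"
      hence "verts G \<subseteq> {x}" using x con
        by (intro closed_set_connected[of x]) (auto simp: arcs_def)
      hence "card (verts G) \<le> card {x}" by (intro card_mono) auto
      thus False using c4 by simp
    qed
    thus ?thesis using that by blast
  qed
  show cAB: "card A = card B"
    using cov[OF e] perfect_matching_bij by (metis bij_betw_same_card)
  thus "2 \<le> card B" using c4 cV by simp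
  fix D assume D: "D \<subseteq> B" "D \<noteq> {}" "D \<noteq> B"
  let ?N = "(arcs A B G)\<inverse> `` D"
  have finN: "finite ?N" by (rule finite_arcs_nbr)
  \<comment> \<open>Otherwise D \<union> N(D) would be closed under adjacency, hence contain all
    vertices, although it misses part of \<open>B\<close>.\<close>
  have "\<exists>a b. (a, b) \<in> arcs A B G \<and> a \<in> ?N \<and> b \<notin> D"
  proof (rule ccontr)
    assume no: "\<not> ?thesis"
    obtain x where x: "x \<in> D" using D by blast
    have "verts G \<subseteq> D \<union> ?N"
    proof (rule closed_set_connected[OF con, of x])
      fix a b assume ab: "(a, b) \<in> arcs A B G"
      hence "a \<in> A" "b \<in> B" using arcs_sub by auto
      hence "a \<notin> D" "b \<notin> ?N" using D arcs_sub disj by auto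
      thus "a \<in> D \<union> ?N \<longleftrightarrow> b \<in> D \<union> ?N" using no ab by blast
    qed (use x D verts_eq in auto)
    hence "B \<subseteq> D \<union> ?N" using verts_eq by auto
    moreover have "?N \<subseteq> A" using arcs_sub by auto
    ultimately show False using D disj by blast
  qed
  then obtain a b where ab: "(a, b) \<in> arcs A B G" "a \<in> ?N" "b \<notin> D" by blast
  then obtain e' where e': "e' \<in> edges G" "ends G e' = {a, b}" "a \<in> A" "b \<in> B"
    by (auto simp: arcs_def)
  obtain M where M: "perfect_matching G M" "e' \<in> M" using cov e' by blast
  obtain p where p: "bij_betw p B A" "p b = a" "\<And>b. b \<in> B \<Longrightarrow> (p b, b) \<in> arcs A B G"
    using perfect_matching_bij[OF M(1)] e' M(2) by metis
  have inj: "inj_on p B" using p(1) by (rule bij_betw_imp_inj_on)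
  \<comment> \<open>As \<open>a\<close> is matched to \<open>b\<close> outside \<open>D\<close>, the
    partners of \<open>D\<close> avoid \<open>a\<close>; this makes Hall's inequality
    strict.\<close>
  have "p ` D \<subseteq> ?N - {a}"
  proof
    fix y assume "y \<in> p ` D"
    then obtain d where d: "d \<in> D" "y = p d" by blast
    hence "y \<noteq> a" using inj_onD[OF inj, of d b] p(2) e' ab(3) D by auto
    thus "y \<in> ?N - {a}" using d p(3)[of d] D by blast
  qed
  hence "card (p ` D) \<le> card (?N - {a})" using finN by (intro card_mono) auto
  also have "\<dots> < card ?N" using finN ab(2) by (intro card_Diff1_less)
  also have "card (p ` D) = card D" using inj D by (intro card_image) (rule inj_on_subset)
  finally show "card D < card ?N" .
qed

lemma matching_coveredI:
  assumes cAB: "card A = card B" and c2: "2 \<le> card B"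
    and sur: "\<And>D. D \<subseteq> B \<Longrightarrow> D \<noteq> {} \<Longrightarrow> D \<noteq> B \<Longrightarrow> card D < card ((arcs A B G)\<inverse> `` D)"
  shows "matching_covered G"
proof -
  let ?N = "\<lambda>D. (arcs A B G)\<inverse> `` D"
  have NA: "?N D \<subseteq> A" for D using arcs_sub by auto
  have finN: "finite (?N D)" for D by (rule finite_arcs_nbr)
  have connected: "connected_graph G"
    unfolding connected_graph_def
  proof (intro conjI ballI)
    show "verts G \<noteq> {}" using c2 verts_eq by auto
    have sym: "(y, x) \<in> adjacency G" if "(x, y) \<in> adjacency G" for x y
      using that by (auto simp: adjacency_def insert_commute)
    have adj: "(a, b) \<in> adjacency G" "(b, a) \<in> adjacency G" if "(a, b) \<in> arcs A B G" for a b
      using that by (auto simp: adjacency_def arcs_def insert_commute)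
    have reachB: "B \<subseteq> {y. (b, y) \<in> (adjacency G)\<^sup>*}" if b: "b \<in> B" for b
    proof (rule ccontr)
      define D where "D = {y \<in> B. (b, y) \<in> (adjacency G)\<^sup>*}"
      assume "\<not> ?thesis"
      hence D: "D \<subseteq> B" "D \<noteq> {}" "D \<noteq> B" using b by (auto simp: D_def)
      \<comment> \<open>\<open>D\<close> and \<open>B - D\<close> would have disjoint
        neighbourhoods, each larger than the set itself, which together exceed |A| = |B|.\<close>
      have "?N D \<inter> ?N (B - D) = {}"
      proof (rule ccontr)
        assume "\<not> ?thesis"
        then obtain a d d' where a: "(a, d) \<in> arcs A B G" "d \<in> D" "(a, d') \<in> arcs A B G" "d' \<in> B - D"
          by blast
        hence "(b, d') \<in> (adjacency G)\<^sup>*" using adj unfolding D_def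
          by (metis (mono_tags, lifting) mem_Collect_eq rtrancl.rtrancl_into_rtrancl)
        thus False using a(4) by (simp add: D_def)
      qed
      hence "card (?N D) + card (?N (B - D)) = card (?N D \<union> ?N (B - D))"
        using finN by (simp add: card_Un_disjoint)
      also have "\<dots> \<le> card A" using NA finite_parts by (intro card_mono) auto
      finally have "card (?N D) + card (?N (B - D)) \<le> card A" .
      moreover have "card D < card (?N D)" using D by (rule sur)
      moreover have "card (B - D) < card (?N (B - D))" using D by (intro sur) auto
      moreover have "card (B - D) = card B - card D"
        using D finite_parts finite_subset by (metis card_Diff_subset)
      ultimately show False using cAB by linarith
    qed
    have toB: "\<exists>b\<in>B. (x, b) \<in> (adjacency G)\<^sup>* \<and> (b, x) \<in> (adjacency G)\<^sup>*" if x: "x \<in> verts G" for x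
    proof (cases "x \<in> B")
      case False
      hence xA: "x \<in> A" using x verts_eq by auto
      obtain b0 where b0: "b0 \<in> B" using c2 by fastforce
      have cD: "card (B - {b0}) = card B - 1" using b0 finite_parts by simp
      have "B - {b0} \<noteq> {}" using cD c2 by (metis One_nat_def Suc_1 card.empty diff_is_0_eq not_less_eq_eq)
      hence "card (B - {b0}) < card (?N (B - {b0}))" using b0 by (intro sur) auto
      hence "card A \<le> card (?N (B - {b0}))" using cD cAB by linarith
      hence "?N (B - {b0}) = A" using NA finite_parts by (metis card_seteq)
      then obtain b where "(x, b) \<in> arcs A B G" "b \<in> B" using xA by blast
      thus ?thesis using adj by blast
    qed auto
    fix u v assume "u \<in> verts G" "v \<in> verts G"
    then obtain b b' where "b \<in> B" "(u, b) \<in> (adjacency G)\<^sup>*" "b' \<in> B" "(b', v) \<in> (adjacency G)\<^sup>*"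
      using toB by metis
    moreover have "(b, b') \<in> (adjacency G)\<^sup>*" using reachB \<open>b \<in> B\<close> \<open>b' \<in> B\<close> by blast
    ultimately show "(u, v) \<in> (adjacency G)\<^sup>*" by (meson rtrancl_trans)
  qed
  have cover: "\<exists>M. perfect_matching G M \<and> e \<in> M" if e: "e \<in> edges G" for e
  proof -
    obtain a b where ab: "a \<in> A" "b \<in> B" "ends G e = {a, b}" using edge_arc[OF e] by metis
    \<comment> \<open>Removing \<open>a\<close> costs a set at most one neighbour, which the strict
      surplus can afford. So Hall's theorem extends the edge \<open>e\<close> to a perfect
      matching.\<close>
    have "\<exists>s. inj_on s (B - {b}) \<and> (\<forall>d\<in>B - {b}. s d \<in> ?N {d} - {a})"
    proof (rule hall_marriage)
      fix J assume J: "J \<subseteq> B - {b}"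
      show "card J \<le> card (\<Union> ((\<lambda>d. ?N {d} - {a}) ` J))"
      proof (cases "J = {}")
        case False
        have "card J < card (?N J)" using J ab False by (intro sur) auto
        moreover have "\<Union> ((\<lambda>d. ?N {d} - {a}) ` J) = ?N J - {a}" by blast
        moreover have "card (?N J) - 1 \<le> card (?N J - {a})"
          using finN by (simp add: card_Diff_singleton_if)
        ultimately show ?thesis by simp
      qed simp
    qed (use finite_parts finN in auto)
    then obtain s where s: "inj_on s (B - {b})" "\<forall>d\<in>B - {b}. s d \<in> ?N {d} - {a}" by blast
    define p where "p = s(b := a)"
    have pinj: "inj_on p B" using s unfolding inj_on_def p_def by auto
    have pA: "p ` B = A"
    proof (rule card_seteq)
      show "p ` B \<subseteq> A" using s ab NA by (fastforce simp: p_def)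
      show "card A \<le> card (p ` B)" using card_image[OF pinj] cAB by simp
    qed (rule finite_parts)
    have "\<exists>f\<in>edges G. ends G f = {p d, d} \<and> (d = b \<longrightarrow> f = e)" if d: "d \<in> B" for d
    proof (cases "d = b")
      case True thus ?thesis using e ab by (auto simp: p_def)
    next
      case False
      hence "(p d, d) \<in> arcs A B G" using s d by (auto simp: p_def)
      thus ?thesis using False by (auto simp: arcs_def)
    qed
    then obtain f where f: "\<And>d. d \<in> B \<Longrightarrow> f d \<in> edges G \<and> ends G (f d) = {p d, d}" "f b = e"
      using ab by metis
    have "perfect_matching G (f ` B)"
      unfolding perfect_matching_def
    proof (intro conjI ballI)
      show "f ` B \<subseteq> edges G" using f by blast
      fix v assume "v \<in> verts G"
      then consider "v \<in> A" "v \<notin> B" | "v \<in> B" "v \<notin> A" using verts_eq not_both by blast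
      thus "\<exists>!x. x \<in> f ` B \<and> v \<in> ends G x"
      proof cases
        case 1
        then obtain d where d: "d \<in> B" "v = p d" using pA by blast
        show ?thesis
        proof (rule ex1I[of _ "f d"])
          show "f d \<in> f ` B \<and> v \<in> ends G (f d)" using d f by auto
          fix x assume "x \<in> f ` B \<and> v \<in> ends G x"
          then obtain d' where "d' \<in> B" "x = f d'" "v \<in> {p d', d'}" using f(1) by auto
          thus "x = f d" using d 1 pinj by (auto dest: inj_onD)
        qed
      next
        case 2
        show ?thesis
        proof (rule ex1I[of _ "f v"])
          show "f v \<in> f ` B \<and> v \<in> ends G (f v)" using 2 f by auto
          fix x assume "x \<in> f ` B \<and> v \<in> ends G x"
          then obtain d' where "d' \<in> B" "x = f d'" "v \<in> {p d', d'}" using f(1) by auto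
          thus "x = f v" using 2 pA by auto
        qed
      qed
    qed
    thus ?thesis using f ab by blast
  qed
  have "card (verts G) = card A + card B"
    unfolding verts_eq using finite_parts disj by (simp add: card_Un_disjoint)
  thus ?thesis using connected cover multi cAB c2 by (simp add: matching_covered_def)
qed

text \<open>Deleting an edge must break the surplus of some \<open>D\<close>, or else
  \<open>matching_coveredI\<close> would apply. Deleting one of two parallel edges changes no arc,
  so there are none. For an edge ab, the only neighbour \<open>D\<close> can lose is
  \<open>a\<close>, and only if \<open>b\<close> was the sole neighbour of \<open>a\<close> in
  \<open>D\<close>; thus \<open>D\<close> is a branch.\<close>

lemma minimal_matching_covered_surplus:
  assumes "minimal_matching_covered G"
  shows "inj_on (ends G) (edges G)" and "minimal_surplus A B (arcs A B G)"
proof -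
  have mc: "matching_covered G"
    and min: "\<And>e. e \<in> edges G \<Longrightarrow> \<not> matching_covered (delete_edge G e)"
    using assms by (auto simp: minimal_matching_covered_def)
  note parts = matching_covered_parts[OF mc]
  have crit: "\<exists>D\<subseteq>B. D \<noteq> {} \<and> D \<noteq> B \<and> card ((arcs A B (delete_edge G e))\<inverse> `` D) \<le> card D"
    if e: "e \<in> edges G" for e
  proof (rule ccontr)
    interpret H: bipartite_multigraph "delete_edge G e" A B by (rule delete)
    assume "\<not> ?thesis"
    hence "card D < card ((arcs A B (delete_edge G e))\<inverse> `` D)"
      if "D \<subseteq> B" "D \<noteq> {}" "D \<noteq> B" for D using that by (meson not_le_imp_less)
    hence "matching_covered (delete_edge G e)" using parts by (intro H.matching_coveredI)
    thus False using min e by blast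
  qed
  show inj: "inj_on (ends G) (edges G)"
  proof (rule inj_onI, rule ccontr)
    fix e e' assume e: "e \<in> edges G" "e' \<in> edges G" "ends G e = ends G e'" "e \<noteq> e'"
    have "arcs A B (delete_edge G e) = arcs A B G"
      using e unfolding arcs_def delete_edge_def by auto
    then obtain D where "D \<subseteq> B" "D \<noteq> {}" "D \<noteq> B" "card ((arcs A B G)\<inverse> `` D) \<le> card D"
      using crit[OF e(1)] by auto
    thus False using parts(3)[of D] by simp
  qed
  show "minimal_surplus A B (arcs A B G)"
  proof
    fix a b assume ab: "(a, b) \<in> arcs A B G"
    let ?E = "arcs A B G"
    obtain e where e: "e \<in> edges G" "ends G e = {a, b}" "a \<in> A" "b \<in> B"
      using ab by (auto simp: arcs_def)
    have del: "?E - {(a, b)} \<subseteq> arcs A B (delete_edge G e)"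
    proof (rule subrelI, rule ccontr)
      fix x y assume xy0: "(x, y) \<in> ?E - {(a, b)}" and xy: "(x, y) \<notin> arcs A B (delete_edge G e)"
      hence "(x, y) \<noteq> (a, b)" by blast
      obtain e' where "x \<in> A" "y \<in> B" "e' \<in> edges G" "ends G e' = {x, y}"
        using xy0 by (auto simp: arcs_def)
      moreover from this have "e' = e" using xy by (auto simp: arcs_def delete_edge_def)
      ultimately show False using e \<open>(x, y) \<noteq> (a, b)\<close> pair_eq_iff[of x y a b] by simp
    qed
    obtain D where D: "D \<subseteq> B" "D \<noteq> {}" "D \<noteq> B" "card ((arcs A B (delete_edge G e))\<inverse> `` D) \<le> card D"
      using crit[OF e(1)] by auto
    have fin: "finite ((arcs A B (delete_edge G e))\<inverse> `` D)"
      by (rule bipartite_multigraph.finite_arcs_nbr[OF delete])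
    have "card ((?E - {(a, b)})\<inverse> `` D) \<le> card ((arcs A B (delete_edge G e))\<inverse> `` D)"
      using del fin by (intro card_mono Image_mono) auto
    hence le: "card ((?E - {(a, b)})\<inverse> `` D) \<le> card D" using D(4) by simp
    have fin': "finite ((?E - {(a, b)})\<inverse> `` D)" using del fin by (rule_tac finite_subset) auto
    have lt: "card D < card (?E\<inverse> `` D)" using parts(3) D by blast
    hence ne: "?E\<inverse> `` D \<noteq> (?E - {(a, b)})\<inverse> `` D" using le by auto
    have bD: "b \<in> D" using ne by blast
    have an: "a \<notin> (?E - {(a, b)})\<inverse> `` D" using ne ab bD by blast
    have "?E\<inverse> `` D \<subseteq> insert a ((?E - {(a, b)})\<inverse> `` D)" by blast
    hence "card (?E\<inverse> `` D) \<le> card (insert a ((?E - {(a, b)})\<inverse> `` D))"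
      using fin' by (intro card_mono) auto
    also have "\<dots> = card ((?E - {(a, b)})\<inverse> `` D) + 1" using an fin' by simp
    finally have "card (?E\<inverse> `` D) \<le> card D + 1" using le by simp
    moreover have "D \<inter> ?E `` {a} = {b}"
      using bD ab an by (intro Int_Image_singletonI) blast+
    ultimately show "\<exists>D\<subseteq>B. D \<inter> ?E `` {a} = {b} \<and> card (?E\<inverse> `` D) \<le> card D + 1"
      using D(1) by blast
  qed (use parts finite_parts arcs_sub in auto)
qed

text \<open>Without parallel edges, edges correspond to arcs. A general \<open>P\<close> on end sets
  serves m, the degrees and \<open>E2\<close> alike.\<close>

lemma card_edges_filter:
  assumes "inj_on (ends G) (edges G)"
  shows "card {e \<in> edges G. P (ends G e)} = card {(a, b) \<in> arcs A B G. P {a, b}}"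
proof -
  have img: "ends G ` {e \<in> edges G. P (ends G e)} = (\<lambda>(a, b). {a, b}) ` {(a, b) \<in> arcs A B G. P {a, b}}"
  proof (intro equalityI subsetI)
    fix s assume "s \<in> ends G ` {e \<in> edges G. P (ends G e)}"
    then obtain e where e: "e \<in> edges G" "P (ends G e)" "s = ends G e" by blast
    obtain a b where "ends G e = {a, b}" "(a, b) \<in> arcs A B G" using edge_arc[OF e(1)] by metis
    thus "s \<in> (\<lambda>(a, b). {a, b}) ` {(a, b) \<in> arcs A B G. P {a, b}}"
      using e by (intro image_eqI[of _ _ "(a, b)"]) auto
  next
    fix s assume "s \<in> (\<lambda>(a, b). {a, b}) ` {(a, b) \<in> arcs A B G. P {a, b}}"
    then obtain a b where ab: "(a, b) \<in> arcs A B G" "P {a, b}" "s = {a, b}" by auto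
    then obtain e where "e \<in> edges G" "ends G e = {a, b}" by (auto simp: arcs_def)
    thus "s \<in> ends G ` {e \<in> edges G. P (ends G e)}"
      using ab by (intro image_eqI[of _ _ e]) auto
  qed
  have inj: "inj_on (ends G) {e \<in> edges G. P (ends G e)}"
    using assms by (rule inj_on_subset) auto
  have inj': "inj_on (\<lambda>(a, b). {a, b}) {(a, b) \<in> arcs A B G. P {a, b}}"
  proof (rule inj_onI, clarify)
    fix a b a' b' assume "(a, b) \<in> arcs A B G" "(a', b') \<in> arcs A B G" "{a, b} = {a', b'}"
    thus "a = a' \<and> b = b'" using arcs_sub pair_eq_iff[of a b a' b'] by blast
  qed
  show ?thesis unfolding card_image[OF inj, symmetric] img by (rule card_image[OF inj'])
qed

lemma degree_arcs:
  assumes "inj_on (ends G) (edges G)" "a \<in> A"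
  shows "degree G a = card (arcs A B G `` {a})"
proof -
  have "degree G a = card {(x, y) \<in> arcs A B G. a \<in> {x, y}}"
    unfolding degree_def using card_edges_filter[OF assms(1), of "\<lambda>s. a \<in> s"] by simp
  also have "{(x, y) \<in> arcs A B G. a \<in> {x, y}} = Pair a ` (arcs A B G `` {a})"
    using assms(2) arcs_sub not_both by auto
  also have "card \<dots> = card (arcs A B G `` {a})" by (simp add: card_image inj_on_def)
  finally show ?thesis .
qed

end

section \<open>Isomorphisms and the graph Theta\<close>

context bipartite_multigraph
begin

text \<open>Surplus of \<open>{b}\<close> gives two neighbours, and a union bound over the incident
  edges turns them into degree two, also with parallel edges.\<close>

lemma matching_covered_degree_right:
  assumes mc: "matching_covered G" and b: "b \<in> B"
  shows "2 \<le> degree G b"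
proof -
  note parts = matching_covered_parts[OF mc]
  have "{b} \<noteq> B" using parts(2) by auto
  hence "2 \<le> card ((arcs A B G)\<inverse> `` {b})" using parts(3)[of "{b}"] b by simp
  also have "(arcs A B G)\<inverse> `` {b} \<subseteq> (\<Union>e\<in>{e \<in> edges G. b \<in> ends G e}. ends G e - {b})"
    using b disj by (fastforce simp: arcs_def)
  hence "card ((arcs A B G)\<inverse> `` {b}) \<le> card (\<Union>e\<in>{e \<in> edges G. b \<in> ends G e}. ends G e - {b})"
    using finite_parts(3) multi
    by (intro card_mono) (auto simp: multigraph_def intro: card_ge_0_finite)
  also have "\<dots> \<le> (\<Sum>e\<in>{e \<in> edges G. b \<in> ends G e}. card (ends G e - {b}))"
    using finite_parts(3) by (intro card_UN_le) simp
  also have "\<dots> = (\<Sum>e\<in>{e \<in> edges G. b \<in> ends G e}. 1)"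
    using multi by (intro sum.cong) (auto simp: multigraph_def)
  finally show ?thesis by (simp add: degree_def)
qed

lemma matching_covered_degree:
  assumes "matching_covered G" "v \<in> verts G"
  shows "2 \<le> degree G v"
  using assms verts_eq matching_covered_degree_right
    bipartite_multigraph.matching_covered_degree_right[OF swap] by blast

text \<open>Deleting an edge leaves its end of degree two with degree one, which a matching covered
  graph does not allow.\<close>

lemma minimal_matching_coveredI:
  assumes mc: "matching_covered G"
    and low: "\<And>e. e \<in> edges G \<Longrightarrow> \<exists>v\<in>ends G e. degree G v = 2"
  shows "minimal_matching_covered G"
  unfolding minimal_matching_covered_def
proof (intro conjI ballI notI mc)
  fix e assume e: "e \<in> edges G" and mc': "matching_covered (delete_edge G e)"
  interpret H: bipartite_multigraph "delete_edge G e" A B by (rule delete)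
  obtain v where v: "v \<in> ends G e" "degree G v = 2" using low e by blast
  have "v \<in> verts (delete_edge G e)" using v e multi by (auto simp: multigraph_def delete_edge_def)
  hence "2 \<le> degree (delete_edge G e) v" using mc' H.matching_covered_degree by blast
  moreover have "{x \<in> edges (delete_edge G e). v \<in> ends (delete_edge G e) x}
      = {x \<in> edges G. v \<in> ends G x} - {e}"
    by (auto simp: delete_edge_def)
  hence "degree (delete_edge G e) v = degree G v - 1"
    using e v by (simp add: degree_def)
  ultimately show False using v by simp
qed

end

lemma bipartiteE:
  assumes "multigraph G" "bipartite G"
  obtains A B where "bipartite_multigraph G A B"
proof -
  obtain A B where "A \<union> B = verts G" "A \<inter> B = {}"
    "\<forall>e\<in>edges G. \<exists>a\<in>A. \<exists>b\<in>B. ends G e = {a, b}"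
    using assms(2) unfolding bipartite_def by blast
  hence "bipartite_multigraph G A B" using assms(1) by unfold_locales auto
  thus ?thesis by (rule that)
qed

section \<open>Invariance under isomorphism\<close>

locale mgraph_iso =
  fixes G :: "('v, 'e) mgraph" and H :: "('w, 'f) mgraph" and f :: "'v \<Rightarrow> 'w" and g :: "'e \<Rightarrow> 'f"
  assumes multi: "multigraph G"
    and bij_f: "bij_betw f (verts G) (verts H)" and bij_g: "bij_betw g (edges G) (edges H)"
    and ends_g: "\<And>e. e \<in> edges G \<Longrightarrow> ends H (g e) = f ` ends G e"
begin

lemma ends_sub: "e \<in> edges G \<Longrightarrow> ends G e \<subseteq> verts G"
  using multi by (auto simp: multigraph_def)

lemma verts_image: "verts H = f ` verts G"
  using bij_f by (simp add: bij_betw_def)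

lemma edges_image: "edges H = g ` edges G"
  using bij_g by (simp add: bij_betw_def)

lemma inj_f: "inj_on f (verts G)" and inj_g: "inj_on g (edges G)"
  using bij_f bij_g by (simp_all add: bij_betw_def)

lemma multigraph_image: "multigraph H"
proof -
  have "card (f ` ends G e) = 2" if "e \<in> edges G" for e
  proof -
    have "inj_on f (ends G e)" using inj_f ends_sub[OF that] by (rule inj_on_subset)
    thus ?thesis using multi that by (simp add: card_image multigraph_def)
  qed
  thus ?thesis using multi ends_sub
    by (auto simp: multigraph_def verts_image edges_image ends_g)
qed

lemma mem_ends_iff: "e \<in> edges G \<Longrightarrow> v \<in> verts G \<Longrightarrow> f v \<in> ends H (g e) \<longleftrightarrow> v \<in> ends G e"
  using inj_on_image_mem_iff[OF inj_f _ ends_sub] by (simp add: ends_g)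

lemma inverse: "mgraph_iso H G (inv_into (verts G) f) (inv_into (edges G) g)"
proof
  show "multigraph H" by (rule multigraph_image)
  show "bij_betw (inv_into (verts G) f) (verts H) (verts G)" using bij_f by (rule bij_betw_inv_into)
  show "bij_betw (inv_into (edges G) g) (edges H) (edges G)" using bij_g by (rule bij_betw_inv_into)
  fix e' assume "e' \<in> edges H"
  then obtain e where e: "e \<in> edges G" "e' = g e" using edges_image by blast
  have "inv_into (verts G) f ` f ` ends G e = ends G e"
    using inj_f ends_sub[OF e(1)] by (rule inv_into_image_cancel)
  thus "ends G (inv_into (edges G) g e') = inv_into (verts G) f ` ends H e'"
    using e inj_g by (simp add: ends_g)
qed

lemma delete: "e \<in> edges G \<Longrightarrow> mgraph_iso (delete_edge G e) (delete_edge H (g e)) f g"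
  using multi bij_f ends_g inj_g
  by unfold_locales
    (auto simp: delete_edge_def multigraph_def bij_betw_def edges_image inj_on_diff inj_on_image_set_diff
      dest: inj_onD)

lemma perfect_matching_image:
  assumes M: "perfect_matching G M"
  shows "perfect_matching H (g ` M)"
  unfolding perfect_matching_def
proof (intro conjI ballI)
  have ME: "M \<subseteq> edges G" using M by (simp add: perfect_matching_def)
  thus "g ` M \<subseteq> edges H" using edges_image by blast
  fix w assume "w \<in> verts H"
  then obtain v where v: "v \<in> verts G" "w = f v" using verts_image by blast
  then obtain e where e: "e \<in> M" "v \<in> ends G e" "\<And>e'. e' \<in> M \<Longrightarrow> v \<in> ends G e' \<Longrightarrow> e' = e"
    using M unfolding perfect_matching_def by blast
  show "\<exists>!x. x \<in> g ` M \<and> w \<in> ends H x"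
  proof (rule ex1I[of _ "g e"])
    show "g e \<in> g ` M \<and> w \<in> ends H (g e)" using e v ME mem_ends_iff by blast
    fix x assume "x \<in> g ` M \<and> w \<in> ends H x"
    then obtain e' where "e' \<in> M" "x = g e'" "f v \<in> ends H (g e')" using v by blast
    thus "x = g e" using e(3) mem_ends_iff v(1) ME by blast
  qed
qed

lemma connected_image:
  assumes "connected_graph G"
  shows "connected_graph H"
proof -
  have adj: "(f u, f v) \<in> adjacency H" if uv: "(u, v) \<in> adjacency G" for u v
  proof -
    obtain e where "e \<in> edges G" "ends G e = {u, v}" using uv by (auto simp: adjacency_def)
    hence "g e \<in> edges H" "ends H (g e) = {f u, f v}" using ends_g edges_image by auto
    thus ?thesis by (auto simp: adjacency_def)
  qed
  have "(f u, f v) \<in> (adjacency H)\<^sup>*" if "(u, v) \<in> (adjacency G)\<^sup>*" for u v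
    using that by induction (auto intro: rtrancl_into_rtrancl adj)
  thus ?thesis using assms by (auto simp: connected_graph_def verts_image)
qed

lemma card_verts: "card (verts H) = card (verts G)" and card_edges: "card (edges H) = card (edges G)"
  using bij_f bij_g by (auto dest: bij_betw_same_card)

lemma matching_covered_image:
  assumes "matching_covered G"
  shows "matching_covered H"
  unfolding matching_covered_def
proof (intro conjI ballI multigraph_image)
  show "connected_graph H" "4 \<le> card (verts H)"
    using assms connected_image card_verts by (auto simp: matching_covered_def)
  fix e' assume "e' \<in> edges H"
  then obtain e where e: "e \<in> edges G" "e' = g e" using edges_image by blast
  then obtain M where "perfect_matching G M" "e \<in> M"
    using assms by (auto simp: matching_covered_def)
  thus "\<exists>M. perfect_matching H M \<and> e' \<in> M" using perfect_matching_image e by blast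
qed

lemma minimal_matching_covered_image:
  assumes min: "minimal_matching_covered G"
  shows "minimal_matching_covered H"
  unfolding minimal_matching_covered_def
proof (intro conjI ballI notI)
  show "matching_covered H"
    using min matching_covered_image by (simp add: minimal_matching_covered_def)
  fix e' assume "e' \<in> edges H" and mc: "matching_covered (delete_edge H e')"
  then obtain e where e: "e \<in> edges G" "e' = g e" using edges_image by blast
  \<comment> \<open>Minimality is pulled back: the inverse isomorphism would make the deletion of
    \<open>e\<close> from \<open>G\<close> matching covered too.\<close>
  interpret D: mgraph_iso "delete_edge G e" "delete_edge H (g e)" f g using e(1) by (rule delete)
  have "matching_covered (delete_edge G e)"
    using mgraph_iso.matching_covered_image[OF D.inverse] mc e by simp
  thus False using min e by (simp add: minimal_matching_covered_def)
qed

lemma bipartite_image: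
  assumes "bipartite G"
  shows "bipartite H"
proof -
  obtain A B where AB: "A \<union> B = verts G" "A \<inter> B = {}"
    "\<forall>e\<in>edges G. \<exists>a\<in>A. \<exists>b\<in>B. ends G e = {a, b}"
    using assms unfolding bipartite_def by (elim exE conjE)
  have "f ` A \<inter> f ` B = {}"
    using inj_on_image_Int[OF inj_f, of A B] AB(1,2) by auto
  moreover have "\<exists>a\<in>f ` A. \<exists>b\<in>f ` B. ends H e' = {a, b}" if e': "e' \<in> edges H" for e'
  proof -
    obtain e where e: "e \<in> edges G" "e' = g e" using e' edges_image by blast
    then obtain a b where "a \<in> A" "b \<in> B" "ends G e = {a, b}" using AB(3) by blast
    thus ?thesis using e by (auto simp: ends_g)
  qed
  ultimately show ?thesis unfolding bipartite_def verts_image AB(1)[symmetric]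
    by (intro exI[of _ "f ` A"] exI[of _ "f ` B"]) auto
qed

lemma degree_image:
  assumes "v \<in> verts G"
  shows "degree H (f v) = degree G v"
proof -
  have "{e' \<in> edges H. f v \<in> ends H e'} = g ` {e \<in> edges G. v \<in> ends G e}"
    using assms mem_ends_iff by (auto simp: edges_image)
  moreover have "inj_on g {e \<in> edges G. v \<in> ends G e}" using inj_g by (rule inj_on_subset) auto
  ultimately show ?thesis by (simp add: degree_def card_image)
qed

lemma card_V2: "card (V2 H) = card (V2 G)"
proof -
  have "V2 H = f ` V2 G" by (auto simp: V2_def verts_image degree_image)
  moreover have "inj_on f (V2 G)" using inj_f by (rule inj_on_subset) (auto simp: V2_def)
  ultimately show ?thesis by (simp add: card_image)
qed

lemma card_E2: "card (E2 H) = card (E2 G)"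
proof -
  have "E2 H = g ` E2 G" using ends_sub
    by (fastforce simp: E2_def edges_image ends_g degree_image)
  moreover have "inj_on g (E2 G)" using inj_g by (rule inj_on_subset) (auto simp: E2_def)
  ultimately show ?thesis by (simp add: card_image)
qed

lemma extremal_image:
  "G \<in> two_edge_n_extremal \<inter> two_vertex_extremal \<Longrightarrow> H \<in> two_edge_n_extremal \<inter> two_vertex_extremal"
  using minimal_matching_covered_image bipartite_image
  by (auto simp: two_edge_n_extremal_def two_vertex_extremal_def card_V2 card_E2 card_verts card_edges)

end

lemma isomorphic_iff: "multigraph G \<Longrightarrow> isomorphic G H \<longleftrightarrow> (\<exists>f g. mgraph_iso G H f g)"
  by (simp add: isomorphic_def mgraph_iso_def Ball_def)

lemma isomorphic_sym:
  assumes "multigraph G" "isomorphic G H"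
  shows "isomorphic H G"
proof -
  obtain f g where "mgraph_iso G H f g" using assms isomorphic_iff by blast
  then interpret mgraph_iso G H f g .
  show ?thesis using isomorphic_iff multigraph_image inverse by blast
qed

section \<open>Theta belongs to both extremal classes\<close>

lemma verts_Theta: "verts Theta = {0, 1, 2, 3, 4, 5, 6, 7}"
  by (auto simp: Theta_def)

lemma edges_Theta: "edges Theta =
    {{0, 2}, {2, 3}, {3, 1}, {0, 4}, {4, 5}, {5, 1}, {0, 6}, {6, 7}, {7, 1}}"
  and ends_Theta [simp]: "ends Theta e = e"
  by (simp_all add: Theta_def)

lemma card_edges_Theta: "card (edges Theta) = 9"
  by (simp add: edges_Theta card_insert_if doubleton_eq_iff)

lemma bipartite_Theta: "bipartite_multigraph Theta {0, 3, 5, 7} {1, 2, 4, 6}"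
proof
  show "multigraph Theta"
    by (simp add: multigraph_def edges_Theta verts_Theta)
  show "verts Theta = {0, 3, 5, 7} \<union> {1, 2, 4, 6}" by (auto simp: verts_Theta)
  show "{0, 3, 5, 7} \<inter> {1, 2, 4, 6 :: nat} = {}" by auto
  fix e assume "e \<in> edges Theta"
  thus "\<exists>a\<in>{0, 3, 5, 7}. \<exists>b\<in>{1, 2, 4, 6}. ends Theta e = {a, b}"
    unfolding edges_Theta by (elim insertE emptyE; simp add: doubleton_eq_iff)
qed

text \<open>Lets the simplifier evaluate comprehensions over explicitly listed sets.\<close>

lemma filter_insert:
  "{e \<in> insert x S. P e} = (if P x then insert x {e \<in> S. P e} else {e \<in> S. P e})"
  by auto

lemma degree_Theta:
  assumes "v \<in> verts Theta" shows "degree Theta v = (if v \<in> {0, 1} then 3 else 2)"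
  using assms unfolding verts_Theta degree_def ends_Theta edges_Theta filter_insert
  by (elim insertE; simp add: card_insert_if doubleton_eq_iff)

lemma matching_covered_Theta: "matching_covered Theta"
proof -
  interpret bipartite_multigraph Theta "{0, 3, 5, 7}" "{1, 2, 4, 6}" by (rule bipartite_Theta)
  have adj: "(0, v) \<in> (adjacency Theta)\<^sup>*" if "v \<in> verts Theta" for v
  proof -
    have step: "{x, y} \<in> edges Theta \<Longrightarrow> (0, x) \<in> (adjacency Theta)\<^sup>* \<Longrightarrow> (0, y) \<in> (adjacency Theta)\<^sup>*" for x y
      by (erule rtrancl_into_rtrancl) (auto simp: adjacency_def)
    have 2: "(0, 2) \<in> (adjacency Theta)\<^sup>*" "(0, 4) \<in> (adjacency Theta)\<^sup>*" "(0, 6) \<in> (adjacency Theta)\<^sup>*"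
      by (rule step[of 0, OF _ rtrancl_refl], simp add: edges_Theta)+
    have 3: "(0, 3) \<in> (adjacency Theta)\<^sup>*" "(0, 5) \<in> (adjacency Theta)\<^sup>*" "(0, 7) \<in> (adjacency Theta)\<^sup>*"
      by (rule step[OF _ 2(1)] step[OF _ 2(2)] step[OF _ 2(3)], simp add: edges_Theta doubleton_eq_iff; fail)+
    have "(0, 1) \<in> (adjacency Theta)\<^sup>*"
      by (rule step[OF _ 3(1)]) (simp add: edges_Theta)
    thus ?thesis using 2 3 that unfolding verts_Theta by (elim insertE emptyE) simp_all
  qed
  have "sym (adjacency Theta)" by (auto simp: sym_def adjacency_def insert_commute)
  hence "sym ((adjacency Theta)\<^sup>*)" by (rule sym_rtrancl)
  hence "connected_graph Theta" unfolding connected_graph_def using adj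
    by (metis empty_iff insertI1 rtrancl_trans symD verts_Theta)
  moreover have "\<exists>M. perfect_matching Theta M \<and> e \<in> M" if "e \<in> edges Theta" for e
  proof -
    have pm: "perfect_matching Theta M"
      if "M \<subseteq> edges Theta" "\<Union> M = verts Theta" "\<forall>e\<in>M. \<forall>e'\<in>M. e \<inter> e' \<noteq> {} \<longrightarrow> e = e'" for M
      using that unfolding perfect_matching_def ends_Theta by blast
    \<comment> \<open>Each of the three matchings takes both end edges of one path and the middle
      edges of the other two; together they cover all nine edges.\<close>
    have "perfect_matching Theta {{0, 2}, {3, 1}, {4, 5}, {6, 7}}"
      "perfect_matching Theta {{0, 4}, {5, 1}, {2, 3}, {6, 7}}"
      "perfect_matching Theta {{0, 6}, {7, 1}, {2, 3}, {4, 5}}"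
      by (rule pm; auto simp: edges_Theta verts_Theta)+
    thus ?thesis using that unfolding edges_Theta by (elim insertE emptyE) blast+
  qed
  ultimately show ?thesis using multi by (simp add: matching_covered_def verts_Theta)
qed

lemma Theta_extremal: "Theta \<in> two_edge_n_extremal \<inter> two_vertex_extremal"
proof -
  interpret bipartite_multigraph Theta "{0, 3, 5, 7}" "{1, 2, 4, 6}" by (rule bipartite_Theta)
  have "minimal_matching_covered Theta"
  proof (rule minimal_matching_coveredI[OF matching_covered_Theta])
    fix e assume "e \<in> edges Theta"
    thus "\<exists>v\<in>ends Theta e. degree Theta v = 2"
      unfolding edges_Theta by (elim insertE) (auto simp: degree_Theta verts_Theta)
  qed
  moreover have "bipartite Theta" unfolding bipartite_def
    using verts_eq[symmetric] disj edge_parts by (intro exI conjI ballI)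
  moreover have "V2 Theta = {2, 3, 4, 5, 6, 7}"
    using degree_Theta unfolding V2_def verts_Theta filter_insert by simp
  moreover have "E2 Theta = {{2, 3}, {4, 5}, {6, 7}}"
    unfolding E2_def edges_Theta ends_Theta filter_insert by (simp add: degree_Theta verts_Theta)
  moreover have "card {{2, 3}, {4, 5}, {6, 7 :: nat}} = 3"
    by (simp add: card_insert_if doubleton_eq_iff)
  \<comment> \<open>With n = 8 and m = 9: (8 + 10) / 6 = 3 and 2 (9 - 8 + 2) = 6.\<close>
  ultimately show ?thesis
    by (simp add: two_edge_n_extremal_def two_vertex_extremal_def card_edges_Theta verts_Theta)
qed

section \<open>The doubly extremal case\<close>

context minimal_surplus
begin

text \<open>Only low vertices have degree below three, and each falls short by one.\<close>

lemma card_E_ge: "3 * card A \<le> card E + card (lowA A E)"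
proof -
  have "card (E `` {a}) + (if a \<in> lowA A E then 1 else 0) \<ge> 3" if "a \<in> A" for a
    using degA_ge2[OF that] that by (auto simp: lowA_def)
  hence "(\<Sum>a\<in>A. 3) \<le> (\<Sum>a\<in>A. card (E `` {a}) + (if a \<in> lowA A E then 1 else 0))"
    by (rule sum_mono)
  also have "\<dots> = card E + (\<Sum>a\<in>A. if a \<in> lowA A E then 1 else 0)"
    by (simp add: sum.distrib card_E)
  also have "(\<Sum>a\<in>A. if a \<in> lowA A E then 1 else 0) = card {a \<in> A. a \<in> lowA A E}"
    using finA by (simp flip: sum.inter_filter)
  also have "{a \<in> A. a \<in> lowA A E} = lowA A E" by (auto simp: lowA_def)
  finally show ?thesis by simp
qed

text \<open>By \<open>low_count\<close> in both classes, \<open>ext\<close> forces each class to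
  have exactly k = m - n + 2 low vertices. Every low vertex of \<open>B\<close> has a low neighbour,
  so \<open>?R\<close>, which represents \<open>E2\<close>, has at least k elements;
  \<open>low\<close> is the condition 6 |E2| = n + 10.\<close>

lemma doubly_extremal_counts:
  assumes ext: "card (lowA A E) + card (lowA B (E\<inverse>)) + 4 * card A = 2 * card E + 4"
    and low: "6 * card (E \<inter> lowA A E \<times> lowA B (E\<inverse>)) = 2 * card A + 10"
  shows "card A = 4" "card E = 9" "card (lowA A E) = 3" "card (lowA B (E\<inverse>)) = 3"
    "card (E \<inter> lowA A E \<times> lowA B (E\<inverse>)) = 3"
proof -
  let ?R = "E \<inter> lowA A E \<times> lowA B (E\<inverse>)"
  have "lowA B (E\<inverse>) \<subseteq> snd ` ?R"
  proof
    fix b assume b: "b \<in> lowA B (E\<inverse>)"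
    then obtain a where "a \<in> lowA A E" "(a, b) \<in> E" using extremal_low_nbr ext by auto
    thus "b \<in> snd ` ?R" using b by force
  qed
  hence yR: "card (lowA B (E\<inverse>)) \<le> card ?R" using finE by (intro surj_card_le) auto
  have x: "card E + 2 \<le> card (lowA A E) + 2 * card A"
    by (rule low_count[OF minimal_surplus_axioms])
  have y: "card E + 2 \<le> card (lowA B (E\<inverse>)) + 2 * card A"
    using low_count[OF dual] card_eq by (simp add: card_inverse)
  have N: "2 \<le> card A" using card_ge2 card_eq by simp
  have eq: "card (lowA A E) + 2 * card A = card E + 2" "card (lowA B (E\<inverse>)) + 2 * card A = card E + 2"
    using x y ext by linarith+
  \<comment> \<open>\<open>low\<close> gives |A| = 3 |R| - 5, so |A| \<ge> 2 forces |R| \<ge> 3,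
    while |A| \<le> 2k - 2 \<le> 2 |R| - 2 forces |R| \<le> 3.\<close>
  have R: "card ?R = 3" using N low eq card_E_ge yR by linarith
  thus A: "card A = 4" using low by linarith
  show "card (lowA A E) = 3" "card (lowA B (E\<inverse>)) = 3"
    using A R eq card_E_ge yR by linarith+
  thus "card E = 9" using A eq by linarith
  show "card ?R = 3" by (rule R)
qed

text \<open>The extremal counts force every low vertex of \<open>B\<close> to have exactly one low neighbour, so
  its other neighbour is the unique vertex \<open>a0\<close> of \<open>A\<close> that is not low.\<close>

lemma doubly_extremal_nbrs:
  assumes ext: "card (lowA A E) + card (lowA B (E\<inverse>)) + 4 * card A = 2 * card E + 4"
    and low: "6 * card (E \<inter> lowA A E \<times> lowA B (E\<inverse>)) = 2 * card A + 10"
    and a0: "A - lowA A E = {a0}"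
  shows "inj_on snd (E \<inter> lowA A E \<times> lowA B (E\<inverse>))"
    and "snd ` (E \<inter> lowA A E \<times> lowA B (E\<inverse>)) = lowA B (E\<inverse>)"
    and "\<And>b. b \<in> lowA B (E\<inverse>) \<Longrightarrow> (a0, b) \<in> E"
proof -
  let ?R = "E \<inter> lowA A E \<times> lowA B (E\<inverse>)"
  note counts = doubly_extremal_counts[OF ext low]
  have finR: "finite ?R" using finE by simp
  show im: "snd ` ?R = lowA B (E\<inverse>)"
  proof
    show "lowA B (E\<inverse>) \<subseteq> snd ` ?R"
    proof
      fix b assume b: "b \<in> lowA B (E\<inverse>)"
      then obtain a where "a \<in> lowA A E" "(a, b) \<in> E" using extremal_low_nbr ext by auto
      thus "b \<in> snd ` ?R" using b by force
    qed
  qed auto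
  \<comment> \<open>A surjection between two sets of three elements is injective.\<close>
  show inj: "inj_on snd ?R" using counts im finR by (intro eq_card_imp_inj_on) simp_all
  fix b assume b: "b \<in> lowA B (E\<inverse>)"
  then obtain a where a: "a \<in> lowA A E" "(a, b) \<in> E" using extremal_low_nbr ext by auto
  have "card (E\<inverse> `` {b}) = 2" using b by (simp add: lowA_def)
  hence "\<not> E\<inverse> `` {b} \<subseteq> {a}" using card_mono[of "{a}" "E\<inverse> `` {b}"] by auto
  then obtain a' where a': "(a', b) \<in> E" "a' \<noteq> a" by auto
  have "a' \<notin> lowA A E"
  proof
    assume "a' \<in> lowA A E"
    hence "(a, b) \<in> ?R" "(a', b) \<in> ?R" using a a' b by auto
    thus False using inj_onD[OF inj, of "(a, b)" "(a', b)"] a'(2) by simp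
  qed
  moreover have "a' \<in> A" using a' E_sub by auto
  ultimately have "a' = a0" using a0 by (metis DiffI singletonD)
  thus "(a0, b) \<in> E" using a' by simp
qed

text \<open>Applied to \<open>E\<close> and to its converse, \<open>doubly_extremal_nbrs\<close>
  makes the three arcs between low vertices a matching, joins the non-low vertex \<open>a0\<close>
  to all low vertices of \<open>B\<close>, and \<open>b0\<close> to all those of \<open>A\<close>.
  This gives three paths from \<open>a0\<close> to \<open>b0\<close>; the edge count nine later
  excludes further edges.\<close>

lemma doubly_extremal_structure:
  assumes ext: "card (lowA A E) + card (lowA B (E\<inverse>)) + 4 * card A = 2 * card E + 4"
    and low: "6 * card (E \<inter> lowA A E \<times> lowA B (E\<inverse>)) = 2 * card A + 10"
  obtains a0 a1 a2 a3 b0 b1 b2 b3 where "distinct [a0, a1, a2, a3]" "distinct [b0, b1, b2, b3]"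
    "A = {a0, a1, a2, a3}" "B = {b0, b1, b2, b3}"
    "{(a0, b1), (a0, b2), (a0, b3), (a1, b1), (a2, b2), (a3, b3), (a1, b0), (a2, b0), (a3, b0)} \<subseteq> E"
proof -
  let ?LA = "lowA A E" and ?LB = "lowA B (E\<inverse>)"
  let ?R = "E \<inter> ?LA \<times> ?LB"
  note counts = doubly_extremal_counts[OF ext low]
  have sub: "?LA \<subseteq> A" "?LB \<subseteq> B" by (auto simp: lowA_def)
  have fin: "finite ?LA" "finite ?LB" using sub finA finB finite_subset by auto
  have "card (A - ?LA) = 1" "card (B - ?LB) = 1"
    using counts card_eq sub fin by (simp_all add: card_Diff_subset)
  then obtain a0 b0 where a0: "A - ?LA = {a0}" and b0: "B - ?LB = {b0}"
    by (elim card_1_singletonE)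
  interpret D: minimal_surplus B A "E\<inverse>" by (rule dual)
  have sw: "E\<inverse> \<inter> ?LB \<times> ?LA = ?R\<inverse>" by auto
  have extD: "card ?LB + card (lowA A ((E\<inverse>)\<inverse>)) + 4 * card B = 2 * card (E\<inverse>) + 4"
    using ext card_eq by (simp add: card_inverse)
  have lowD: "6 * card (E\<inverse> \<inter> ?LB \<times> lowA A ((E\<inverse>)\<inverse>)) = 2 * card B + 10"
    using low card_eq by (simp add: sw card_inverse)
  note nA = doubly_extremal_nbrs[OF ext low a0]
  note nB = D.doubly_extremal_nbrs[OF extD lowD b0]
  obtain r1 r2 r3 where R: "?R = {r1, r2, r3}" "r1 \<noteq> r2" "r2 \<noteq> r3" "r1 \<noteq> r3"
    using counts(5) unfolding card_3_iff by blast
  obtain a1 b1 a2 b2 a3 b3 where r: "r1 = (a1, b1)" "r2 = (a2, b2)" "r3 = (a3, b3)"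
    by (metis surj_pair)
  have LB: "?LB = {b1, b2, b3}" using nA(2) unfolding R(1) r by simp
  have "snd ` (?R\<inverse>) = ?LA" using nB(2) by (simp add: sw)
  moreover have "?R\<inverse> = {(b1, a1), (b2, a2), (b3, a3)}" unfolding R(1) r by auto
  ultimately have LA: "?LA = {a1, a2, a3}" by (metis image_empty image_insert snd_conv)
  have dB: "distinct [b1, b2, b3]" using counts(4) unfolding LB by (auto simp: card_insert_if split: if_splits)
  have dA: "distinct [a1, a2, a3]" using counts(3) unfolding LA by (auto simp: card_insert_if split: if_splits)
  have "a0 \<notin> ?LA" "a0 \<in> A" "b0 \<notin> ?LB" "b0 \<in> B" using a0 b0 by blast+
  moreover have "A = insert a0 ?LA" "B = insert b0 ?LB" using a0 b0 sub by blast+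
  moreover have "{(a1, b1), (a2, b2), (a3, b3)} \<subseteq> E" using R(1) r by auto
  moreover have "(a0, b1) \<in> E" "(a0, b2) \<in> E" "(a0, b3) \<in> E" using nA(3) LB by auto
  moreover have "(a1, b0) \<in> E" "(a2, b0) \<in> E" "(a3, b0) \<in> E" using nB(3) LA by auto
  ultimately show ?thesis using dA dB LA LB by (intro that[of a0 a1 a2 a3 b0 b1 b2 b3]) auto
qed

end

section \<open>Identifying a doubly extremal graph with Theta\<close>

context bipartite_multigraph
begin

lemma extremal_imp_Theta:
  assumes mem: "G \<in> two_edge_n_extremal \<inter> two_vertex_extremal"
  shows "isomorphic Theta G"
proof -
  have min: "minimal_matching_covered G"
    and e2: "real (card (E2 G)) = (real (card (verts G)) + 10) / 6"
    and v2: "int (card (V2 G)) = 2 * (int (card (edges G)) - int (card (verts G)) + 2)"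
    using mem by (auto simp: two_edge_n_extremal_def two_vertex_extremal_def)
  define E where "E = arcs A B G"
  note inj = minimal_matching_covered_surplus(1)[OF min]
  interpret S: minimal_surplus A B E
    unfolding E_def by (rule minimal_matching_covered_surplus(2)[OF min])
  have degA: "degree G a = card (E `` {a})" if "a \<in> A" for a
    using degree_arcs[OF inj that] by (simp add: E_def)
  have degB: "degree G b = card (E\<inverse> `` {b})" if "b \<in> B" for b
    using bipartite_multigraph.degree_arcs[OF swap inj that] by (simp add: E_def arcs_swap)
  have cV: "card (verts G) = 2 * card A"
    unfolding verts_eq using finite_parts disj S.card_eq by (simp add: card_Un_disjoint)
  have cE: "card (edges G) = card E"
    using card_edges_filter[OF inj, of "\<lambda>_. True"] by (simp add: E_def)
  have "V2 G = lowA A E \<union> lowA B (E\<inverse>)"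
    using degA degB by (auto simp: V2_def lowA_def verts_eq)
  moreover have "lowA A E \<inter> lowA B (E\<inverse>) = {}" using disj by (auto simp: lowA_def)
  moreover have "finite (lowA A E)" "finite (lowA B (E\<inverse>))" using finite_parts by (auto simp: lowA_def)
  ultimately have "card (V2 G) = card (lowA A E) + card (lowA B (E\<inverse>))"
    by (simp add: card_Un_disjoint)
  hence ext: "card (lowA A E) + card (lowA B (E\<inverse>)) + 4 * card A = 2 * card E + 4"
    using v2 unfolding cV cE by simp
  have "card (E2 G) = card {(a, b) \<in> E. \<forall>v\<in>{a, b}. degree G v = 2}"
    unfolding E2_def E_def by (rule card_edges_filter[OF inj])
  also have "{(a, b) \<in> E. \<forall>v\<in>{a, b}. degree G v = 2} = E \<inter> lowA A E \<times> lowA B (E\<inverse>)"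
    using S.E_sub degA degB by (auto simp: lowA_def)
  finally have "card (E2 G) = card (E \<inter> lowA A E \<times> lowA B (E\<inverse>))" .
  hence low: "6 * card (E \<inter> lowA A E \<times> lowA B (E\<inverse>)) = 2 * card A + 10"
    using e2 cV by (simp add: field_simps)
  obtain a0 a1 a2 a3 b0 b1 b2 b3 where s: "distinct [a0, a1, a2, a3]" "distinct [b0, b1, b2, b3]"
    "A = {a0, a1, a2, a3}" "B = {b0, b1, b2, b3}"
    "{(a0, b1), (a0, b2), (a0, b3), (a1, b1), (a2, b2), (a3, b3), (a1, b0), (a2, b0), (a3, b0)} \<subseteq> E"
    using S.doubly_extremal_structure[OF ext low] .
  \<comment> \<open>Position i holds the image of vertex i of Theta: 0 and 1 go to \<open>a0\<close>
    and \<open>b0\<close>, and the path 0-2-3-1 to \<open>a0\<close>, \<open>b1\<close>,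
    \<open>a1\<close>, \<open>b0\<close>; likewise the other two.\<close>
  define vs where "vs = [a0, b0, b1, a1, b2, a2, b3, a3]"
  have "distinct vs" using s(1,2) disj unfolding s(3,4) vs_def by auto
  moreover have "set vs = verts G" unfolding verts_eq s(3,4) vs_def by auto
  moreover have len: "length vs = 8" by (simp add: vs_def)
  ultimately have bij: "bij_betw ((!) vs) {0..<8} (verts G)"
    by (metis bij_betw_nth atLeast0LessThan)
  have "\<exists>x\<in>edges G. ends G x = (!) vs ` e" if e: "e \<in> edges Theta" for e
  proof -
    have arc: "\<exists>x\<in>edges G. ends G x = {a, b}" "\<exists>x\<in>edges G. ends G x = {b, a}" if "(a, b) \<in> E" for a b
      using that by (auto simp: E_def arcs_def insert_commute)
    show ?thesis using e s(5) unfolding edges_Theta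
      by (elim insertE emptyE) (auto simp: vs_def intro: arc)
  qed
  then obtain g where g: "\<And>e. e \<in> edges Theta \<Longrightarrow> g e \<in> edges G \<and> ends G (g e) = (!) vs ` e"
    by metis
  have sub: "e \<subseteq> {0..<8}" if "e \<in> edges Theta" for e
    using that by (auto simp: edges_Theta)
  have injg: "inj_on g (edges Theta)"
  proof (rule inj_onI)
    fix e e' assume e: "e \<in> edges Theta" "e' \<in> edges Theta" "g e = g e'"
    hence "(!) vs ` e = (!) vs ` e'" using g by metis
    thus "e = e'"
      using inj_on_image_eq_iff[OF bij_betw_imp_inj_on[OF bij] sub[OF e(1)] sub[OF e(2)]] by blast
  qed
  \<comment> \<open>Both graphs have nine edges, so the injection \<open>g\<close> is onto and
    \<open>G\<close> has no edges outside the three paths.\<close>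
  have "g ` edges Theta = edges G"
  proof (rule card_seteq)
    show "card (edges G) \<le> card (g ` edges Theta)"
      using card_image[OF injg] card_edges_Theta cE S.doubly_extremal_counts(2)[OF ext low] by simp
  qed (use g finite_parts in auto)
  hence "bij_betw g (edges Theta) (edges G)" using injg by (simp add: bij_betw_def)
  thus ?thesis unfolding isomorphic_def using bij g
    by (intro exI[of _ "(!) vs"] exI[of _ g]) (auto simp: Theta_def)
qed

end

theorem corollary7p12:
  fixes G :: "('v, 'e) mgraph"
  assumes "multigraph G"
  shows "G \<in> two_edge_n_extremal \<inter> two_vertex_extremal \<longleftrightarrow> isomorphic G Theta"
proof
  assume mem: "G \<in> two_edge_n_extremal \<inter> two_vertex_extremal"
  hence "bipartite G" by (simp add: two_edge_n_extremal_def)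
  then obtain A B where "bipartite_multigraph G A B" using bipartiteE assms by blast
  hence "isomorphic Theta G" using mem by (rule bipartite_multigraph.extremal_imp_Theta)
  moreover have "multigraph Theta" using bipartite_Theta by (rule bipartite_multigraph.multi)
  ultimately show "isomorphic G Theta" using isomorphic_sym by blast
next
  assume "isomorphic G Theta"
  hence "isomorphic Theta G" using assms isomorphic_sym by blast
  moreover have "multigraph Theta" using bipartite_Theta by (rule bipartite_multigraph.multi)
  ultimately obtain f g where "mgraph_iso Theta G f g" using isomorphic_iff by blast
  thus "G \<in> two_edge_n_extremal \<inter> two_vertex_extremal"
    using Theta_extremal by (rule mgraph_iso.extremal_image)
qed

end
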